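(* Assume the Generalized Riemann Hypothesis (GRH). Let $\chi$ be a primitive Dirichlet character of order $3$ and conductor $q$. Then, as $q\to\infty$, $$\left( \frac{1}{\sqrt{2}} + o(1) \right) \left(\frac{\zeta(3)}{e^{\gamma}\log_2 q}\right)^{1/2} \leq |L(1,\chi)| \leq \left( 2 + o(1) \right) e^\gamma \log_2 q.$$
   Context: $L(s,\chi)=\sum_{n\ge1}\chi(n)n^{-s}$ is the Dirichlet $L$-function, $\gamma$ is the Euler–Mascheroni constant, and $\log_j$ denotes the $j$-fold iterated logarithm (so $\log_2 q=\log\log q$). *)

theory Defs
  imports "HOL-Analysis.Analysis"
begin

definition dirichlet_char :: "nat \<Rightarrow> (nat \<Rightarrow> complex) \<Rightarrow> bool" where
  "dirichlet_char q chi \<longleftrightarrow> q > 0 \<and>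
     (\<forall>m n. chi (m * n) = chi m * chi n) \<and>
     (\<forall>n. chi (n + q) = chi n) \<and>
     (\<forall>n. chi n \<noteq> 0 \<longleftrightarrow> coprime n q)"

definition principal_char :: "nat \<Rightarrow> (nat \<Rightarrow> complex) \<Rightarrow> bool" where
  "principal_char q chi \<longleftrightarrow> (\<forall>n. chi n = (if coprime n q then 1 else 0))"

text \<open>Character of order exactly 3 (3 is prime, so chi^3 principal and chi nonprincipal).\<close>
definition char_order3 :: "nat \<Rightarrow> (nat \<Rightarrow> complex) \<Rightarrow> bool" where
  "char_order3 q chi \<longleftrightarrow> dirichlet_char q chi \<and> \<not> principal_char q chi \<and>
     (\<forall>n. chi n ^ 3 = (if coprime n q then 1 else 0))"

definition primitive_char :: "nat \<Rightarrow> (nat \<Rightarrow> complex) \<Rightarrow> bool" where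
  "primitive_char q chi \<longleftrightarrow> dirichlet_char q chi \<and>
     (\<forall>d. d dvd q \<and> d < q \<longrightarrow>
        \<not> (\<forall>m n. coprime m q \<and> coprime n q \<and> m mod d = n mod d \<longrightarrow> chi m = chi n))"

text \<open>Dirichlet series L(s,chi) = sum_{n>=1} chi(n) n^{-s} (n = 0 term is 0).\<close>
definition dirichlet_L :: "(nat \<Rightarrow> complex) \<Rightarrow> complex \<Rightarrow> complex" where
  "dirichlet_L chi s = (\<Sum>n. chi n / of_nat n powr s)"

text \<open>Dirichlet eta function, eta(s) = (1 - 2^{1-s}) zeta(s), convergent for Re s > 0.\<close>
definition dirichlet_eta :: "complex \<Rightarrow> complex" where
  "dirichlet_eta s = (\<Sum>n. (-1) ^ (n + 1) / of_nat n powr s)"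

text \<open>GRH: no zeros of zeta (via eta) and of L(s,chi) for nonprincipal chi in 1/2 < Re s < 1.\<close>
definition GRH :: bool where
  "GRH \<longleftrightarrow>
     (\<forall>s. 1/2 < Re s \<and> Re s < 1 \<longrightarrow> dirichlet_eta s \<noteq> 0) \<and>
     (\<forall>q chi s. dirichlet_char q chi \<and> \<not> principal_char q chi \<and> 1/2 < Re s \<and> Re s < 1
        \<longrightarrow> dirichlet_L chi s \<noteq> 0)"

definition zeta3 :: real where
  "zeta3 = (\<Sum>n. 1 / (real (Suc n)) ^ 3)"

end

theory Submission
  imports Defs "HOL-Complex_Analysis.Complex_Analysis" "HOL-Number_Theory.Prime_Powers"
    "HOL-Number_Theory.Residues" "HOL-Real_Asymp.Real_Asymp"
begin

text \<open>
  Write \<open>w(n) = \<Lambda>(n) / ln n\<close>, so that \<open>log L(s, \<chi>) = \<Sum> w(n) \<chi>(n) n\<^sup>-\<^sup>s\<close> for \<open>Re s > 1\<close>. Under GRH this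
  logarithm continues to \<open>Re s > 1/2\<close> and is \<open>O(log q + |t|)\<close> there by Borel--Caratheodory.
  Let \<open>E(s)\<close> be its difference from the partial sum over \<open>n \<le> N\<close>. The maximum modulus principle for
  \<open>E(1 + z) N\<^sup>z exp(z\<^sup>2)\<close> on the strip \<open>-\<eta> \<le> Re z \<le> 1\<close>, with \<open>\<eta>\<close> slightly below \<open>1/2\<close>, combined with
  Chebyshev's bound on both edges, gives \<open>E(1) = o(1)\<close> as soon as \<open>N = (ln q)\<^sup>a\<close> with \<open>a > 2\<close>. It remains
  to bound \<open>Re \<Sum>\<^sub>n\<^sub>\<le>\<^sub>N w(n) \<chi>(n) / n\<close>: from above by \<open>\<Sum>\<^sub>n\<^sub>\<le>\<^sub>N w(n) / n \<le> ln ln N + \<gamma> + o(1)\<close> (Mertens), and from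
  below by using \<open>Re \<chi> \<ge> -1/2\<close> together with \<open>\<chi>(m\<^sup>3) = 1\<close>, where the cubes produce \<open>ln \<zeta>(3)\<close>.
\<close>

section \<open>The logarithm of an Euler product\<close>

definition primepow_weight :: "nat \<Rightarrow> real" where
  "primepow_weight n = mangoldt n / ln (real n)"

lemma primepow_weight_nonneg: "primepow_weight n \<ge> 0"
  unfolding primepow_weight_def
  by (cases "n = 0") (auto intro!: divide_nonneg_nonneg mangoldt_nonneg)

lemma primepow_weight_le_1: "primepow_weight n \<le> 1"
  using mangoldt_le[of n]
  by (cases "n > 1") (auto simp: primepow_weight_def divide_le_eq not_less le_Suc_eq)

lemma primepow_weight_0 [simp]: "primepow_weight 0 = 0"
  and primepow_weight_Suc_0 [simp]: "primepow_weight (Suc 0) = 0"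
  by (simp_all add: primepow_weight_def)

lemma primepow_weight_prime_power:
  assumes "prime p"
  shows "primepow_weight (p ^ k) = 1 / real k"
proof (cases "k = 0")
  case False
  then show ?thesis
    using assms prime_gt_1_nat[OF assms] by (simp add: primepow_weight_def ln_realpow)
qed auto

lemma primepow_weight_eq_0: "\<not> primepow n \<Longrightarrow> primepow_weight n = 0"
  by (simp add: primepow_weight_def mangoldt_def)

lemma primepow_weight_cube: "primepow_weight (m ^ 3) = primepow_weight m / 3"
proof (cases "primepow m")
  case True
  then obtain p k where "prime p" "m = p ^ k" unfolding primepow_def by auto
  then show ?thesis by (simp add: primepow_weight_prime_power power_mult[symmetric] mult.commute)
next
  case False
  then have "\<not> primepow (m ^ 3)" by (cases "m = 0") (auto simp: primepow_power_iff_nat)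
  then show ?thesis using False by (simp add: primepow_weight_eq_0)
qed

lemma summable_primepow_weight_mult:
  fixes f :: "nat \<Rightarrow> 'a::real_normed_algebra_1"
  assumes "summable (\<lambda>n. norm (f n))"
  shows "summable (\<lambda>n. norm (of_real (primepow_weight n) * f n))"
proof (rule summable_comparison_test'[OF assms, of 0])
  show "norm (norm (of_real (primepow_weight n) * f n)) \<le> norm (f n)" for n
    by (simp add: scaleR_conv_of_real[symmetric]
      primepow_weight_nonneg primepow_weight_le_1 mult_left_le_one_le)
qed

lemma infsum_UNIV_eq_suminf:
  fixes f :: "nat \<Rightarrow> 'a::banach"
  assumes "summable (\<lambda>n. norm (f n))"
  shows "infsum f UNIV = (\<Sum>n. f n)"
  using norm_summable_imp_has_sum[OF assms summable_sums[OF summable_norm_cancel[OF assms]]]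
  by (rule infsumI)

lemma norm_summable_imp_summable_on_subset:
  fixes f :: "nat \<Rightarrow> 'a::banach"
  assumes "summable (\<lambda>n. norm (f n))"
  shows "f summable_on A"
  by (rule summable_on_subset_banach[OF norm_summable_imp_summable_on[OF assms]]) simp

lemma infsum_eventually_exhausting_tendsto:
  fixes f :: "nat \<Rightarrow> 'a::{real_normed_algebra, banach}"
  assumes "summable (\<lambda>n. norm (f n))"
    and "\<And>n. f n \<noteq> 0 \<Longrightarrow> \<forall>\<^sub>F N in sequentially. n \<in> A N"
  shows "(\<lambda>N. infsum f (A N)) \<longlonglongrightarrow> (\<Sum>n. f n)"
proof -
  have "infsum f B = (\<Sum>n. if n \<in> B then f n else 0)" for B
  proof -
    have "infsum f B = infsum (\<lambda>n. if n \<in> B then f n else 0) UNIV"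
      by (rule infsum_cong_neutral) auto
    also have "\<dots> = (\<Sum>n. if n \<in> B then f n else 0)"
      by (rule infsum_UNIV_eq_suminf[OF summable_comparison_test'[OF assms(1), of 0]]) auto
    finally show ?thesis .
  qed
  moreover have "(\<lambda>N. \<Sum>n. if n \<in> A N then f n else 0) \<longlonglongrightarrow> (\<Sum>n. f n)"
  proof (rule tannerys_theorem[THEN conjunct2, THEN conjunct2])
    show "(\<lambda>N. if n \<in> A N then f n else 0) \<longlonglongrightarrow> f n" for n
      using assms(2)[of n]
      by (intro tendsto_eventually) (cases "f n = 0"; auto elim: eventually_mono)
  qed (use assms(1) in \<open>auto intro!: always_eventually\<close>)
  ultimately show ?thesis by simp
qed

definition smooth :: "nat \<Rightarrow> nat set" where
  "smooth N = {n. n > 0 \<and> (\<forall>p. prime p \<and> p dvd n \<longrightarrow> p < N)}"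

definition primepows_below :: "nat \<Rightarrow> nat set" where
  "primepows_below N = {n. primepow n \<and> aprimedivisor n < N}"

lemma smooth_0: "smooth 0 = {1}"
  unfolding smooth_def using prime_factor_nat by (auto dest: prime_gt_0_nat)

lemma eventually_mem_smooth: "n > 0 \<Longrightarrow> \<forall>\<^sub>F N in sequentially. n \<in> smooth N"
  using eventually_gt_at_top[of n] by eventually_elim (auto simp: smooth_def dest!: dvd_imp_le)

lemma smooth_Suc_not_prime: "\<not> prime N \<Longrightarrow> smooth (Suc N) = smooth N"
  unfolding smooth_def by (metis less_Suc_eq)

lemma smooth_Suc_prime:
  assumes "prime N"
  shows "smooth (Suc N) = smooth N \<union> (*) N ` smooth (Suc N)"
    "smooth N \<inter> (*) N ` smooth (Suc N) = {}"
proof -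
  have "N * m \<in> smooth (Suc N) \<longleftrightarrow> m \<in> smooth (Suc N)" for m
    using assms prime_gt_0_nat[OF assms]
    by (auto simp: smooth_def prime_dvd_mult_iff dest: primes_dvd_imp_eq)
  then have "(*) N ` smooth (Suc N) = {n \<in> smooth (Suc N). N dvd n}" by (auto elim!: dvdE)
  moreover have "smooth N = {n \<in> smooth (Suc N). \<not> N dvd n}"
    using assms by (auto simp: smooth_def less_Suc_eq)
  ultimately show "smooth (Suc N) = smooth N \<union> (*) N ` smooth (Suc N)"
    "smooth N \<inter> (*) N ` smooth (Suc N) = {}"
    by auto
qed

lemma primepows_below_Suc_not_prime: "\<not> prime N \<Longrightarrow> primepows_below (Suc N) = primepows_below N"
  unfolding primepows_below_def primepow_def by (auto simp: less_Suc_eq aprimedivisor_prime_power)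

lemma primepows_below_Suc_prime:
  assumes "prime N"
  shows "primepows_below (Suc N) = primepows_below N \<union> (\<lambda>k. N ^ k) ` {0<..}"
    "primepows_below N \<inter> (\<lambda>k. N ^ k) ` {0<..} = {}"
proof -
  have "(\<lambda>k. N ^ k) ` {0<..} = {n. primepow n \<and> aprimedivisor n = N}"
    using assms by (auto simp: primepow_def aprimedivisor_prime_power)
  then show "primepows_below (Suc N) = primepows_below N \<union> (\<lambda>k. N ^ k) ` {0<..}"
    "primepows_below N \<inter> (\<lambda>k. N ^ k) ` {0<..} = {}"
    by (auto simp: primepows_below_def)
qed

locale summable_completely_multiplicative =
  fixes f :: "nat \<Rightarrow> complex"
  assumes zero: "f 0 = 0" and one: "f 1 = 1" and mult: "f (m * n) = f m * f n"
    and summable: "summable (\<lambda>n. norm (f n))"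
begin

lemma power: "f (m ^ k) = f m ^ k"
  by (induction k) (use one mult in auto)

lemma norm_less_1:
  assumes "p \<ge> 2"
  shows "norm (f p) < 1"
proof -
  have "inj (\<lambda>k. p ^ k)" using assms by (auto intro!: injI simp: power_inject_exp)
  then have "summable ((\<lambda>n. norm (f n)) \<circ> (\<lambda>k. p ^ k))" by (intro summable_reindex summable) auto
  then have "summable (\<lambda>k. norm (f p) ^ k)" by (simp add: o_def power norm_power)
  then show ?thesis by (simp add: summable_geometric_iff)
qed

lemma infsum_smooth_Suc:
  assumes "prime N"
  shows "infsum f (smooth (Suc N)) * (1 - f N) = infsum f (smooth N)"
proof -
  have "infsum f (smooth (Suc N)) = infsum f (smooth N) + infsum f ((*) N ` smooth (Suc N))"
    by (subst smooth_Suc_prime(1)[OF assms])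
      (rule infsum_Un_disjoint[OF _ _ smooth_Suc_prime(2)[OF assms]];
       rule norm_summable_imp_summable_on_subset[OF summable])
  also have "infsum f ((*) N ` smooth (Suc N)) = infsum (\<lambda>n. f N * f n) (smooth (Suc N))"
    using prime_gt_0_nat[OF assms] by (subst infsum_reindex) (auto intro!: inj_onI simp: o_def mult)
  also have "\<dots> = f N * infsum f (smooth (Suc N))" by (rule infsum_cmult_right')
  finally have "infsum f (smooth (Suc N)) - f N * infsum f (smooth (Suc N)) = infsum f (smooth N)"
    unfolding diff_eq_eq .
  then show ?thesis by (simp add: algebra_simps)
qed

definition log_term :: "nat \<Rightarrow> complex" where
  "log_term n = of_real (primepow_weight n) * f n"

lemma summable_norm_log_term: "summable (\<lambda>n. norm (log_term n))"
  unfolding log_term_def by (rule summable_primepow_weight_mult[OF summable])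

lemma infsum_log_term_prime_powers:
  assumes "prime p"
  shows "infsum log_term ((\<lambda>k. p ^ k) ` {0<..}) = - Ln (1 - f p)"
proof -
  have p: "norm (f p) < 1" by (rule norm_less_1[OF prime_ge_2_nat[OF assms]])
  have "summable (\<lambda>k. norm (f p ^ k / of_nat k))"
    using p by (intro summable_comparison_test'[OF summable_geometric[of "norm (f p)"], of 1])
      (auto simp: norm_divide norm_power divide_le_eq mult_le_cancel_left1 not_less)
  moreover have "(\<lambda>k. f p ^ k / of_nat k) sums (- Ln (1 - f p))"
    using sums_minus[OF Ln_series'[of "- f p"]] p by simp
  ultimately have "((\<lambda>k. f p ^ k / of_nat k) has_sum - Ln (1 - f p)) UNIV"
    by (rule norm_summable_imp_has_sum)
  moreover have "infsum (\<lambda>k. log_term (p ^ k)) {0<..} = infsum (\<lambda>k. f p ^ k / of_nat k) UNIV"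
    by (rule infsum_cong_neutral)
      (auto simp: log_term_def primepow_weight_prime_power[OF assms] power)
  ultimately show ?thesis
    using prime_gt_1_nat[OF assms]
    by (subst infsum_reindex) (auto intro!: inj_onI simp: infsumI o_def)
qed

lemma infsum_primepows_below_Suc:
  assumes "prime N"
  shows "infsum log_term (primepows_below (Suc N))
      = infsum log_term (primepows_below N) - Ln (1 - f N)"
proof -
  have "infsum log_term (primepows_below (Suc N))
      = infsum log_term (primepows_below N) + infsum log_term ((\<lambda>k. N ^ k) ` {0<..})"
    unfolding primepows_below_Suc_prime(1)[OF assms]
    by (rule infsum_Un_disjoint[OF _ _ primepows_below_Suc_prime(2)[OF assms]];
        rule norm_summable_imp_summable_on_subset[OF summable_norm_log_term])
  then show ?thesis by (simp add: infsum_log_term_prime_powers[OF assms])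
qed

lemma exp_infsum_primepows_below:
  "exp (infsum log_term (primepows_below N)) = infsum f (smooth N)"
proof (induction N)
  case 0
  then show ?case using one by (simp add: primepows_below_def smooth_0)
next
  case (Suc N)
  show ?case
  proof (cases "prime N")
    case True
    have "1 - f N \<noteq> 0" using norm_less_1[OF prime_ge_2_nat[OF True]] by auto
    then show ?thesis
      using Suc infsum_smooth_Suc[OF True] infsum_primepows_below_Suc[OF True]
      by (simp add: exp_diff nonzero_divide_eq_eq)
  qed (use Suc in \<open>simp add: smooth_Suc_not_prime primepows_below_Suc_not_prime\<close>)
qed

text \<open>Stated for the exponential of the series, so that no branch of the logarithm is involved.\<close>

theorem exp_suminf_primepow_weight:
  "exp (\<Sum>n. of_real (primepow_weight n) * f n) = (\<Sum>n. f n)"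
proof (rule LIMSEQ_unique)
  have "\<forall>\<^sub>F N in sequentially. n \<in> primepows_below N" if "log_term n \<noteq> 0" for n
    using eventually_gt_at_top[of "aprimedivisor n"]
    by eventually_elim
      (use that primepow_weight_eq_0[of n] in \<open>auto simp: log_term_def primepows_below_def\<close>)
  then show "(\<lambda>N. exp (infsum log_term (primepows_below N)))
      \<longlonglongrightarrow> exp (\<Sum>n. of_real (primepow_weight n) * f n)"
    unfolding log_term_def[symmetric]
    by (intro tendsto_exp infsum_eventually_exhausting_tendsto summable_norm_log_term)
  have "\<forall>\<^sub>F N in sequentially. n \<in> smooth N" if "f n \<noteq> 0" for n
    using that zero by (intro eventually_mem_smooth) (metis gr0I)
  then show "(\<lambda>N. exp (infsum log_term (primepows_below N))) \<longlonglongrightarrow> (\<Sum>n. f n)"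
    unfolding exp_infsum_primepows_below by (rule infsum_eventually_exhausting_tendsto[OF summable])
qed

end

lemma exp_suminf_primepow_weight_real:
  fixes f :: "nat \<Rightarrow> real"
  assumes "f 0 = 0" "f 1 = 1" "\<And>m n. f (m * n) = f m * f n" "summable (\<lambda>n. \<bar>f n\<bar>)"
  shows "exp (\<Sum>n. primepow_weight n * f n) = (\<Sum>n. f n)"
proof -
  interpret summable_completely_multiplicative "\<lambda>n. complex_of_real (f n)"
    using assms by unfold_locales simp_all
  have "summable (\<lambda>n. primepow_weight n * f n)"
    using summable_norm_cancel[OF summable_primepow_weight_mult[of f]] assms(4) by simp
  moreover have "summable f" using assms(4) by (rule summable_rabs_cancel)
  ultimately have "complex_of_real (exp (\<Sum>n. primepow_weight n * f n)) = of_real (\<Sum>n. f n)"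
    using exp_suminf_primepow_weight by (simp flip: suminf_of_real exp_of_real of_real_mult)
  then show ?thesis by (simp only: of_real_eq_iff)
qed

section \<open>Chebyshev's bound\<close>

lemma ln_fact_eq_sum_mangoldt:
  "ln (fact n) = (\<Sum>d\<le>n. mangoldt d * real (n div d))"
proof (induction n)
  case (Suc n)
  have "mangoldt d * real (Suc n div d)
      = mangoldt d * real (n div d) + (if d dvd Suc n then mangoldt d else 0)" for d
    by (cases "d dvd Suc n") (simp_all add: div_Suc dvd_eq_mod_eq_0 distrib_left)
  then have "(\<Sum>d\<le>Suc n. mangoldt d * real (Suc n div d))
      = (\<Sum>d\<le>Suc n. mangoldt d * real (n div d)) + (\<Sum>d\<le>Suc n. if d dvd Suc n then mangoldt d else 0)"
    by (simp only: sum.distrib)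
  also have "(\<Sum>d\<le>Suc n. if d dvd Suc n then mangoldt d else 0)
      = (\<Sum>d | d dvd Suc n. mangoldt d :: real)"
    by (intro sum.mono_neutral_cong_right) (auto dest: dvd_imp_le)
  also have "\<dots> = ln (real (Suc n))"
    by (subst mangoldt_sum) auto
  finally show ?case
    using Suc by (simp add: ln_mult)
qed auto

lemma ln_central_binomial_eq_sum_mangoldt:
  "ln (real ((2*n) choose n)) = (\<Sum>d\<le>2*n. mangoldt d * (real (2*n div d) - 2 * real (n div d)))"
proof -
  have "ln (real ((2*n) choose n)) = ln (fact (2*n)) - 2 * ln (fact n)"
    by (simp add: binomial_fact ln_div ln_mult)
  also have "ln (fact n) = (\<Sum>d\<le>2*n. mangoldt d * real (n div d))"
    unfolding ln_fact_eq_sum_mangoldt by (intro sum.mono_neutral_left) auto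
  also have "ln (fact (2*n)) - 2 * \<dots>
      = (\<Sum>d\<le>2*n. mangoldt d * (real (2*n div d) - 2 * real (n div d)))"
    unfolding ln_fact_eq_sum_mangoldt by (simp add: sum_subtractf sum_distrib_left algebra_simps)
  finally show ?thesis .
qed

lemma sum_mangoldt_double_le:
  "(\<Sum>d\<le>2*n. mangoldt d :: real) \<le> (\<Sum>d\<le>n. mangoldt d) + 2 * real n * ln 2"
proof -
  let ?m = "\<lambda>d. real (2*n div d) - 2 * real (n div d)"
  have "?m d \<ge> 0" for d
  proof -
    have "2 * (n div d) \<le> 2 * n div d"
      by (cases "d = 0") (auto simp: less_eq_div_iff_mult_less_eq algebra_simps)
    then show ?thesis by linarith
  qed
  moreover have "mangoldt d \<le> mangoldt d * ?m d" if d: "d \<in> {n<..2*n}" for d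
  proof -
    from d have "2*n div d \<ge> 1" "n div d = 0" by (auto simp: div_greater_zero_iff Suc_le_eq)
    then show ?thesis using mangoldt_nonneg[of d] by (simp add: mult_le_cancel_left1)
  qed
  ultimately have "(\<Sum>d\<in>{n<..2*n}. mangoldt d :: real) \<le> (\<Sum>d\<le>2*n. mangoldt d * ?m d)"
    by (intro order.trans[OF sum_mono sum_mono2]) (auto intro!: mult_nonneg_nonneg mangoldt_nonneg)
  also have "\<dots> = ln (real ((2*n) choose n))"
    by (rule ln_central_binomial_eq_sum_mangoldt[symmetric])
  also have "\<dots> \<le> ln (2 ^ (2*n))"
    using binomial_le_pow2[of "2*n" n]
    by (intro ln_mono) (auto simp: zero_less_binomial simp flip: of_nat_power)
  also have "\<dots> = 2 * real n * ln 2" by (simp add: ln_realpow)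
  finally have "(\<Sum>d\<in>{n<..2*n}. mangoldt d :: real) \<le> 2 * real n * ln 2" .
  moreover have "(\<Sum>d\<le>2*n. mangoldt d :: real) = (\<Sum>d\<le>n. mangoldt d) + (\<Sum>d\<in>{n<..2*n}. mangoldt d)"
    by (subst sum.union_disjoint [symmetric]) (auto intro!: sum.cong)
  ultimately show ?thesis by simp
qed

theorem sum_mangoldt_le: "(\<Sum>d\<le>n. mangoldt d :: real) \<le> 4 * real n"
proof (induction n rule: less_induct)
  case (less n)
  show ?case
  proof (cases "n \<le> 1")
    case True
    then show ?thesis by (cases n) auto
  next
    case False
    define m where "m = (n + 1) div 2"
    have m: "m < n" "n \<le> 2 * m" "6 * m \<le> 4 * n" using False unfolding m_def by presburger+
    have "(\<Sum>d\<le>n. mangoldt d :: real) \<le> (\<Sum>d\<le>2*m. mangoldt d)"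
      using m by (intro sum_mono2) (auto simp: mangoldt_nonneg)
    also have "\<dots> \<le> (\<Sum>d\<le>m. mangoldt d) + 2 * real m * ln 2" by (rule sum_mangoldt_double_le)
    also have "\<dots> \<le> 4 * real m + 2 * real m * 1"
      using less[OF m(1)] ln_2_less_1 by (intro add_mono mult_left_mono) auto
    also have "\<dots> \<le> 4 * real n" using m(3) by linarith
    finally show ?thesis .
  qed
qed

section \<open>Convergence of the Mertens sum\<close>

lemma ln_fact_le: "ln (fact n) \<le> real n * ln (real n)"
proof (cases "n = 0")
  case False
  then have "ln (fact n) \<le> ln (real n ^ n)"
    using fact_le_power[of n, where 'a = real] by (subst ln_le_cancel_iff) auto
  then show ?thesis by (simp add: ln_realpow)
qed auto

lemma ln_fact_ge: "ln (fact n) \<ge> real n * ln (real n) - real n"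
proof (cases "n = 0")
  case False
  have "(\<Sum>k\<in>{n}. inverse (fact k) *\<^sub>R real n ^ k) \<le> exp (real n)"
    unfolding exp_def by (intro sum_le_suminf) (auto intro: summable_exp)
  then have "real n ^ n / fact n \<le> exp (real n)" by (simp add: field_simps)
  then have "ln (real n ^ n / fact n) \<le> ln (exp (real n))"
    using False by (subst ln_le_cancel_iff) auto
  then show ?thesis using False by (simp add: ln_div ln_realpow)
qed auto

lemma of_nat_div_bounds:
  fixes n d :: nat
  shows "real (n div d) \<le> real n / real d" "real n / real d \<le> real (n div d) + 1"
proof -
  show "real (n div d) \<le> real n / real d" by (rule of_nat_div_le_of_nat)
  show "real n / real d \<le> real (n div d) + 1"
    using mod_less_divisor[of d n]
    by (cases "d = 0") (auto simp: of_nat_of_nat_div_aux[of n d] divide_le_eq_1 less_imp_le)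
qed

theorem abs_sum_mangoldt_over_minus_ln_le:
  assumes "n \<ge> 1"
  shows "\<bar>(\<Sum>d\<le>n. mangoldt d / real d) - ln (real n)\<bar> \<le> 4"
proof -
  let ?S = "\<Sum>d\<le>n. mangoldt d / real d"
  have "ln (fact n) \<le> (\<Sum>d\<le>n. mangoldt d * (real n / real d))"
    unfolding ln_fact_eq_sum_mangoldt
    by (intro sum_mono mult_left_mono of_nat_div_bounds mangoldt_nonneg)
  also have "\<dots> = real n * ?S" by (simp add: sum_distrib_left mult_ac)
  finally have lower: "ln (fact n) \<le> real n * ?S" .
  have "real n * ?S = (\<Sum>d\<le>n. mangoldt d * (real n / real d))"
    by (simp add: sum_distrib_left mult_ac)
  also have "\<dots> \<le> (\<Sum>d\<le>n. mangoldt d * (real (n div d) + 1))"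
    by (intro sum_mono mult_left_mono of_nat_div_bounds mangoldt_nonneg)
  also have "\<dots> = ln (fact n) + (\<Sum>d\<le>n. mangoldt d)"
    by (simp add: ln_fact_eq_sum_mangoldt distrib_left sum.distrib)
  finally have "real n * ?S \<le> real n * (ln (real n) + 4)"
    using ln_fact_le[of n] sum_mangoldt_le[of n] by (simp add: algebra_simps)
  moreover have "real n * (ln (real n) - 1) \<le> real n * ?S"
    using lower ln_fact_ge[of n] by (simp add: algebra_simps)
  ultimately show ?thesis using assms by (simp add: abs_le_iff)
qed

lemma summation_by_parts:
  fixes a b :: "nat \<Rightarrow> 'a::comm_ring"
  shows "(\<Sum>k<n. a k * b k) = (\<Sum>k<n. (\<Sum>j\<le>k. a j) * (b k - b (Suc k))) + (\<Sum>j<n. a j) * b n"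
  by (induction n) (auto simp: algebra_simps lessThan_Suc_atMost[symmetric])

lemma Dirichlet_test:
  fixes a b :: "nat \<Rightarrow> 'a::{real_normed_field, banach}"
  assumes bounded: "\<And>n. norm (\<Sum>j\<le>n. a j) \<le> B" and lim: "b \<longlonglongrightarrow> 0"
    and variation: "summable (\<lambda>n. norm (b n - b (Suc n)))"
  shows "(\<lambda>n. a n * b n) sums (\<Sum>n. (\<Sum>j\<le>n. a j) * (b n - b (Suc n)))"
    and "norm (\<Sum>n. a n * b n) \<le> B * (\<Sum>n. norm (b n - b (Suc n)))"
proof -
  let ?c = "\<lambda>n. (\<Sum>j\<le>n. a j) * (b n - b (Suc n))"
  have term_le: "norm (?c n) \<le> B * norm (b n - b (Suc n))" for n
    by (simp add: norm_mult mult_right_mono[OF bounded])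
  have summable: "summable (\<lambda>n. norm (?c n))"
    by (rule summable_comparison_test'[OF summable_mult[OF variation, of B], of 0])
      (use term_le in auto)
  have "norm (\<Sum>j<n. a j) \<le> B" for n
    using bounded[of "n - 1"] order.trans[OF norm_ge_zero bounded[of 0]]
    by (cases n) (auto simp: lessThan_Suc_atMost)
  then have "\<forall>n. norm ((\<Sum>j<n. a j) * b n) \<le> B * norm (b n)"
    by (simp add: norm_mult mult_right_mono)
  moreover have "(\<lambda>n. B * norm (b n)) \<longlonglongrightarrow> 0"
    using tendsto_mult_left[OF tendsto_norm_zero[OF lim], of B] by simp
  ultimately have "(\<lambda>n. (\<Sum>j<n. a j) * b n) \<longlonglongrightarrow> 0"
    by (rule Lim_null_comparison[OF always_eventually])
  from tendsto_add[OF summable_LIMSEQ[OF summable_norm_cancel[OF summable]] this]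
  show sums: "(\<lambda>n. a n * b n) sums (\<Sum>n. ?c n)"
    unfolding sums_def summation_by_parts[of a b] by simp
  have "norm (\<Sum>n. ?c n) \<le> (\<Sum>n. B * norm (b n - b (Suc n)))"
    using summable_norm[OF summable] suminf_le[OF term_le summable summable_mult[OF variation]]
    by (rule order.trans)
  also have "\<dots> = B * (\<Sum>n. norm (b n - b (Suc n)))" by (rule suminf_mult[OF variation])
  finally show "norm (\<Sum>n. a n * b n) \<le> B * (\<Sum>n. norm (b n - b (Suc n)))"
    using sums by (simp add: sums_iff)
qed

lemma Dirichlet_test_decseq:
  fixes a :: "nat \<Rightarrow> 'a::{real_normed_field, banach}"
  assumes "\<And>n. norm (\<Sum>j\<le>n. a j) \<le> B" "b \<longlonglongrightarrow> 0" "decseq b"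
  shows "summable (\<lambda>n. a n * of_real (b n))" "norm (\<Sum>n. a n * of_real (b n)) \<le> B * b 0"
proof -
  have "norm (of_real (b n) - of_real (b (Suc n)) :: 'a) = b n - b (Suc n)" for n
    using decseqD[OF assms(3), of n "Suc n"] by (simp flip: of_real_diff)
  then have "(\<lambda>n. norm (of_real (b n) - of_real (b (Suc n)) :: 'a)) sums (b 0)"
    using telescope_sums'[OF assms(2)] by simp
  then have diff: "summable (\<lambda>n. norm (of_real (b n) - of_real (b (Suc n)) :: 'a))"
      "(\<Sum>n. norm (of_real (b n) - of_real (b (Suc n)) :: 'a)) = b 0"
    by (simp_all add: sums_iff)
  have lim: "(\<lambda>n. of_real (b n) :: 'a) \<longlonglongrightarrow> 0" using tendsto_of_real[OF assms(2)] by simp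
  note test = Dirichlet_test[OF assms(1) lim diff(1)]
  show "summable (\<lambda>n. a n * of_real (b n))" by (rule sums_summable[OF test(1)])
  show "norm (\<Sum>n. a n * of_real (b n)) \<le> B * b 0" using test(2) by (simp only: diff(2))
qed

definition primepow_harm :: "nat \<Rightarrow> real" where
  "primepow_harm n = (\<Sum>d\<le>n. primepow_weight d / real d)"

lemma primepow_harm_conv_sum:
  "primepow_harm (n + 2) = (\<Sum>j\<le>n. mangoldt (j + 2) / (real (j + 2) * ln (real (j + 2))))"
proof (induction n)
  case 0
  show ?case by (simp add: primepow_harm_def primepow_weight_def numeral_2_eq_2)
next
  case (Suc n)
  have "primepow_harm (Suc n + 2)
      = primepow_harm (n + 2) + primepow_weight (Suc n + 2) / real (Suc n + 2)"
    by (simp add: primepow_harm_def)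
  then show ?case using Suc by (simp add: primepow_weight_def mult_ac)
qed

lemma abs_sum_mangoldt_minus_1_over_le: "\<bar>\<Sum>j\<le>n. (mangoldt (j + 2) - 1) / real (j + 2)\<bar> \<le> 6"
proof -
  have "(\<Sum>j\<le>n. (mangoldt (j + 2) - 1) / real (j + 2))
      = (\<Sum>d\<le>n+2. mangoldt d / real d) - harm (n + 2) + 1"
  proof (induction n)
    case 0
    show ?case by (simp add: harm_Suc harm_def[of 0] numeral_2_eq_2 field_simps)
  next
    case (Suc n)
    have "harm (Suc n + 2) = harm (n + 2) + 1 / real (Suc n + 2)"
      using harm_Suc[of "n + 2", where 'a = real] by (simp add: inverse_eq_divide)
    then show ?case using Suc by (simp add: diff_divide_distrib del: of_nat_Suc of_nat_add)
  qed
  moreover have "harm (n + 2) - ln (real (n + 2)) \<ge> 0" "harm (n + 2) - ln (real (n + 2)) \<le> 1"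
    using euler_mascheroni_sequence_nonneg[of "n + 2"]
      euler_mascheroni_sequence_decreasing[of 1 "n + 2"] by (auto simp: harm_expand)
  ultimately show ?thesis
    using abs_sum_mangoldt_over_minus_ln_le[of "n + 2"] by simp
qed

lemma convergent_sum_inverse_mult_ln:
  "convergent (\<lambda>n. (\<Sum>j\<le>n. 1 / (real (j + 2) * ln (real (j + 2)))) - ln (ln (real (n + 2))))"
proof -
  interpret antimono_fun_sum_integral_diff "\<lambda>x. 1 / ((x + 2) * ln (x + 2))"
  proof
    show "1 / ((y + 2) * ln (y + 2)) \<le> 1 / ((x + 2) * ln (x + 2))"
        if "0 \<le> x" "x \<le> y" for x y :: real
      using that by (intro divide_left_mono mult_mono mult_pos_pos) auto
  qed (auto intro!: continuous_intros)
  have "((\<lambda>x. 1 / ((x + 2) * ln (x + 2)))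
      has_integral ln (ln (real n + 2)) - ln (ln (0 + 2))) {0..real n}" for n
  proof (rule fundamental_theorem_of_calculus)
    fix x assume "x \<in> {0..real n}"
    then show "((\<lambda>x. ln (ln (x + 2)))
        has_vector_derivative 1 / ((x + 2) * ln (x + 2))) (at x within {0..real n})"
      unfolding has_real_derivative_iff_has_vector_derivative [symmetric]
      by (auto intro!: derivative_eq_intros simp: field_simps)
  qed auto
  then have "integral {0..real n} (\<lambda>x. 1 / ((x + 2) * ln (x + 2)))
      = ln (ln (real n + 2)) - ln (ln 2)" for n
    by (simp add: integral_unique)
  then have "(\<Sum>j\<le>n. 1 / (real (j + 2) * ln (real (j + 2)))) - ln (ln (real (n + 2)))
      = sum_integral_diff_series n - ln (ln 2)" for n
    by (simp add: sum_integral_diff_series_def add.commute)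
  then show ?thesis
    by (simp only: convergent_diff[OF sum_integral_diff_series_convergent convergent_const])
qed

theorem convergent_primepow_harm: "convergent (\<lambda>n. primepow_harm n - ln (ln (real n)))"
proof -
  define a where "a n = (mangoldt (n + 2) - 1) / real (n + 2)" for n
  define b where "b n = 1 / ln (real (n + 2))" for n
  have "decseq b" unfolding b_def by (intro decseq_SucI divide_left_mono mult_pos_pos) auto
  moreover have "b \<longlonglongrightarrow> 0" unfolding b_def by real_asymp
  ultimately have "summable (\<lambda>n. a n * b n)"
    using Dirichlet_test_decseq(1)[of a 6 b] abs_sum_mangoldt_minus_1_over_le by (simp add: a_def)
  then have "convergent (\<lambda>n. \<Sum>j\<le>n. a j * b j)"
    by (simp add: summable_iff_convergent')
  note conv = convergent_add[OF this convergent_sum_inverse_mult_ln]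
  have "primepow_harm (n + 2)
      = (\<Sum>j\<le>n. a j * b j) + (\<Sum>j\<le>n. 1 / (real (j + 2) * ln (real (j + 2))))" for n
    unfolding primepow_harm_conv_sum sum.distrib [symmetric]
    by (intro sum.cong) (auto simp: a_def b_def diff_divide_distrib)
  then have "convergent (\<lambda>n. primepow_harm (n + 2) - ln (ln (real (n + 2))))"
    using conv by (simp add: algebra_simps)
  then show ?thesis
    using convergent_ignore_initial_segment[of "\<lambda>n. primepow_harm n - ln (ln (real n))" 2] by simp
qed

section \<open>The constant in Mertens' theorem\<close>

lemma powser_tail_le:
  fixes a :: "nat \<Rightarrow> 'a::{real_normed_field, banach}"
  assumes "\<And>k. norm (\<Sum>j=N..<k. a j) \<le> B" and r: "0 < r" "r < 1"
  shows "norm ((\<Sum>n<N. a n * of_real (r ^ n)) - (\<Sum>n. a n * of_real (r ^ n))) \<le> B"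
proof -
  have "norm (\<Sum>j\<le>n. a (j + N)) \<le> B" for n
    using assms(1)[of "Suc n + N"] sum.shift_bounds_nat_ivl[of a 0 N "Suc n"]
    by (simp add: atLeast0LessThan lessThan_Suc_atMost)
  moreover have "(\<lambda>n. r ^ (n + N)) \<longlonglongrightarrow> 0"
    using r by (intro LIMSEQ_ignore_initial_segment LIMSEQ_realpow_zero) auto
  moreover have "decseq (\<lambda>n. r ^ (n + N))"
    using r by (intro decseq_SucI power_decreasing) auto
  ultimately have tail: "summable (\<lambda>n. a (n + N) * of_real (r ^ (n + N)))"
      "norm (\<Sum>n. a (n + N) * of_real (r ^ (n + N))) \<le> B * r ^ (0 + N)"
    by (rule Dirichlet_test_decseq)+
  have "summable (\<lambda>n. a n * of_real (r ^ n))"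
    using tail(1) by (subst (asm) summable_iff_shift)
  then have "norm ((\<Sum>n<N. a n * of_real (r ^ n)) - (\<Sum>n. a n * of_real (r ^ n)))
      = norm (\<Sum>n. a (n + N) * of_real (r ^ (n + N)))"
    by (subst suminf_split_initial_segment[of _ N]) auto
  also have "\<dots> \<le> B * 1"
    using r order.trans[OF norm_ge_zero assms(1)]
    by (intro order.trans[OF tail(2)] mult_left_mono power_le_one) auto
  finally show ?thesis by simp
qed

theorem Abel_limit_theorem:
  fixes a :: "nat \<Rightarrow> 'a::{real_normed_field, banach}"
  assumes "summable a"
  shows "((\<lambda>r. \<Sum>n. a n * of_real (r ^ n)) \<longlongrightarrow> (\<Sum>n. a n)) (at_left (1::real))"
proof -
  have "((\<lambda>r. \<Sum>n. a n * of_real (r ^ n)) \<longlongrightarrow> (\<Sum>n. a n)) (at 1 within {0<..<1::real})"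
  proof (rule swap_uniform_limit)
    show "\<forall>\<^sub>F N in sequentially. ((\<lambda>r. \<Sum>n<N. a n * of_real (r ^ n)) \<longlongrightarrow> (\<Sum>n<N. a n * of_real (1 ^ n)))
        (at 1 within {0<..<1::real})"
      by (intro always_eventually allI tendsto_intros)
    show "(\<lambda>N. \<Sum>n<N. a n * of_real (1 ^ n)) \<longlonglongrightarrow> (\<Sum>n. a n)"
      using summable_LIMSEQ[OF assms] by simp
    show "uniform_limit {0<..<1} (\<lambda>N r. \<Sum>n<N. a n * of_real (r ^ n))
        (\<lambda>r. \<Sum>n. a n * of_real (r ^ n)) sequentially"
    proof (rule uniform_limitI)
      fix e :: real assume e: "e > 0"
      obtain M where M: "\<And>N k. N \<ge> M \<Longrightarrow> norm (\<Sum>j=N..<k. a j) < e / 2"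
        using assms[unfolded summable_Cauchy, rule_format, of "e / 2"] e by auto
      have "dist (\<Sum>n<N. a n * of_real (r ^ n)) (\<Sum>n. a n * of_real (r ^ n)) < e"
        if "N \<ge> M" "r \<in> {0<..<1}" for N r
        using powser_tail_le[of a N "e / 2" r] M[OF that(1)] that(2) e unfolding dist_norm
        by (force simp: less_imp_le)
      then show "\<forall>\<^sub>F N in sequentially. \<forall>r\<in>{0<..<1}.
          dist (\<Sum>n<N. a n * of_real (r ^ n)) (\<Sum>n. a n * of_real (r ^ n)) < e"
        unfolding eventually_sequentially by blast
    qed
  qed auto
  moreover have "at 1 within {0<..<1} = at_left (1::real)"
    by (rule at_within_nhd[of _ "{0<..}"]) auto
  ultimately show ?thesis by simp
qed

lemma powr_le_diff_quotient:
  fixes x \<sigma> :: real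
  assumes "x > 0" "\<sigma> \<ge> -1" "\<sigma> \<noteq> 0"
  shows "(x + 1) powr (-(1 + \<sigma>)) \<le> (x powr (-\<sigma>) - (x + 1) powr (-\<sigma>)) / \<sigma>"
proof -
  have "\<exists>z>x. z < x + 1 \<and> (x + 1) powr (-\<sigma>) - x powr (-\<sigma>) = (x + 1 - x) * (- \<sigma> * z powr (-\<sigma> - 1))"
    using assms by (intro MVT2[of x "x + 1" "\<lambda>x. x powr (-\<sigma>)" "\<lambda>z. - \<sigma> * z powr (-\<sigma> - 1)"])
      (auto intro!: derivative_eq_intros)
  then obtain z where z: "x < z" "z < x + 1" "x powr (-\<sigma>) - (x + 1) powr (-\<sigma>) = \<sigma> * z powr (-\<sigma> - 1)"
    by (auto simp: algebra_simps)
  have "(x + 1) powr (-\<sigma> - 1) \<le> z powr (-\<sigma> - 1)"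
    using z assms by (intro powr_mono2') auto
  moreover have exponent: "-(1 + \<sigma>) = -\<sigma> - 1" by simp
  ultimately show ?thesis unfolding exponent using z(3) assms(3) by simp
qed

lemma summable_powr:
  assumes "\<sigma> > 0"
  shows "summable (\<lambda>n. real n powr (-(1 + \<sigma>)))"
  using assms by (subst summable_real_powr_iff) auto

lemma summable_powr_tail:
  assumes "\<sigma> > 0"
  shows "summable (\<lambda>n. real (n + N) powr (-(1 + \<sigma>)))"
  using summable_powr[OF assms] by (subst summable_iff_shift)

lemma suminf_powr_tail_le:
  assumes "\<sigma> > 0" "N \<ge> 1"
  shows "(\<Sum>n. real (n + Suc N) powr (-(1 + \<sigma>))) \<le> real N powr (-\<sigma>) / \<sigma>"
proof -
  have "(\<lambda>n. real (n + N) powr (-\<sigma>)) \<longlonglongrightarrow> 0"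
    using assms by real_asymp
  from sums_divide[OF telescope_sums'[OF this], of \<sigma>]
  have telescope: "(\<lambda>n. (real (n + N) powr (-\<sigma>) - real (Suc n + N) powr (-\<sigma>)) / \<sigma>)
      sums (real N powr (-\<sigma>) / \<sigma>)"
    by simp
  have "(\<Sum>n. real (n + Suc N) powr (-(1 + \<sigma>)))
      \<le> (\<Sum>n. (real (n + N) powr (-\<sigma>) - real (Suc n + N) powr (-\<sigma>)) / \<sigma>)"
  proof (rule suminf_le)
    show "real (n + Suc N) powr (-(1 + \<sigma>))
        \<le> (real (n + N) powr (-\<sigma>) - real (Suc n + N) powr (-\<sigma>)) / \<sigma>" for n
      using powr_le_diff_quotient[of "real (n + N)" \<sigma>] assms by (simp add: add_ac)
  qed (rule summable_powr_tail[OF assms(1)] sums_summable[OF telescope])+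
  then show ?thesis using telescope by (simp add: sums_iff)
qed

lemma suminf_powr_le:
  assumes "\<sigma> > 0"
  shows "(\<Sum>n. real n powr (-(1 + \<sigma>))) \<le> 1 + 1 / \<sigma>"
  using suminf_split_initial_segment[OF summable_powr[OF assms], of 2]
    suminf_powr_tail_le[OF assms, of 1]
  by (simp add: numeral_2_eq_2)

lemma summable_primepow_weight_powr:
  assumes "\<sigma> > 0"
  shows "summable (\<lambda>n. primepow_weight n * real n powr (-(1 + \<sigma>)))"
  using summable_norm_cancel[OF summable_primepow_weight_mult[of "\<lambda>n. real n powr (-(1 + \<sigma>))"]]
    summable_powr[OF assms] by simp

lemma suminf_primepow_weight_powr_le:
  assumes "\<sigma> > 0"
  shows "(\<Sum>n. primepow_weight n * real n powr (-(1 + \<sigma>))) \<le> ln (1 + 1 / \<sigma>)"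
proof -
  have "exp (\<Sum>n. primepow_weight n * real n powr (-(1 + \<sigma>))) = (\<Sum>n. real n powr (-(1 + \<sigma>)))"
    by (rule exp_suminf_primepow_weight_real)
      (use summable_powr[OF assms] in \<open>auto simp: powr_mult\<close>)
  also have "\<dots> \<le> 1 + 1 / \<sigma>" by (rule suminf_powr_le[OF assms])
  finally show ?thesis using assms by (subst ln_ge_iff) (auto intro: add_pos_pos)
qed

lemma sum_consecutive_intervals:
  fixes g :: "nat \<Rightarrow> 'a::comm_monoid_add" and N :: "nat \<Rightarrow> nat"
  assumes "mono N"
  shows "(\<Sum>m<M. \<Sum>n\<in>{N m<..N (Suc m)}. g n) = (\<Sum>n\<in>{N 0<..N M}. g n)"
proof (induction M)
  case (Suc M)
  have "{N 0<..N (Suc M)} = {N 0<..N M} \<union> {N M<..N (Suc M)}"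
    using monoD[OF assms, of 0 M] monoD[OF assms, of M "Suc M"] by auto
  then show ?case using Suc by (simp add: sum.union_disjoint)
qed auto

definition floor_exp :: "nat \<Rightarrow> nat" where
  "floor_exp m = nat \<lfloor>exp (real m)\<rfloor>"

lemma mono_floor_exp: "mono floor_exp"
  unfolding floor_exp_def by (intro monoI nat_mono floor_mono) auto

lemma floor_exp_0 [simp]: "floor_exp 0 = 1"
  by (simp add: floor_exp_def)

lemma le_floor_exp_iff: "n \<le> floor_exp m \<longleftrightarrow> real n \<le> exp (real m)"
  by (simp add: floor_exp_def le_nat_iff le_floor_iff)

lemma filterlim_floor_exp: "filterlim floor_exp at_top sequentially"
  unfolding floor_exp_def
  by (intro filterlim_compose[OF filterlim_nat_sequentially]
    filterlim_compose[OF filterlim_floor_sequentially])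
    real_asymp

lemma ln_ln_floor_exp_tendsto: "(\<lambda>m. ln (ln (real (floor_exp m))) - ln (real m)) \<longlonglongrightarrow> 0"
proof (rule tendsto_sandwich)
  show "(\<lambda>m. ln (ln (exp (real m) - 1)) - ln (real m)) \<longlonglongrightarrow> 0" by real_asymp
  have bounds: "\<forall>\<^sub>F m in sequentially. exp (real m) - 1 \<le> real (floor_exp m) \<and>
      real (floor_exp m) \<le> exp (real m) \<and> exp (real m) - 1 > 1"
  proof -
    have "\<forall>\<^sub>F m in sequentially. exp (real m) > 2" by real_asymp
    then show ?thesis by eventually_elim (unfold floor_exp_def, linarith)
  qed
  then show "\<forall>\<^sub>F m in sequentially. ln (ln (exp (real m) - 1)) - ln (real m)
      \<le> ln (ln (real (floor_exp m))) - ln (real m)"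
    by eventually_elim (intro diff_right_mono ln_mono ln_gt_zero; linarith)
  from bounds have "\<forall>\<^sub>F m in sequentially. ln (ln (real (floor_exp m))) \<le> ln (ln (exp (real m)))"
    by eventually_elim (intro ln_mono ln_gt_zero; linarith)
  then show "\<forall>\<^sub>F m in sequentially. ln (ln (real (floor_exp m))) - ln (real m) \<le> 0" by simp
qed auto

definition exp_block_sum :: "nat \<Rightarrow> real" where
  "exp_block_sum m = (\<Sum>n\<in>{floor_exp m<..floor_exp (Suc m)}. primepow_weight n / real n)"

lemma sum_exp_block_sum: "(\<Sum>m<M. exp_block_sum m) = primepow_harm (floor_exp M)"
proof -
  have "primepow_harm (floor_exp M) = (\<Sum>n\<in>{1<..floor_exp M}. primepow_weight n / real n)"
    unfolding primepow_harm_def by (intro sum.mono_neutral_right) (auto simp: not_less le_Suc_eq)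
  then show ?thesis
    unfolding exp_block_sum_def sum_consecutive_intervals[OF mono_floor_exp] by simp
qed

lemma power_mult_exp_block_sum_le:
  assumes "\<sigma> > 0"
  shows "exp (-\<sigma>) ^ Suc m * exp_block_sum m
     \<le> (\<Sum>n\<in>{floor_exp m<..floor_exp (Suc m)}. primepow_weight n * real n powr (-(1 + \<sigma>)))"
  unfolding exp_block_sum_def sum_distrib_left
proof (intro sum_mono)
  fix n assume "n \<in> {floor_exp m<..floor_exp (Suc m)}"
  then have n: "n > 0" "real n \<le> exp (real (Suc m))"
    by (auto simp: le_floor_exp_iff simp del: of_nat_Suc)
  have "exp (-\<sigma>) ^ Suc m = exp (real (Suc m)) powr (-\<sigma>)"
    by (simp only: exp_of_nat_mult[symmetric] exp_powr_real
        mult_minus_right mult_minus_left mult.commute)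
  also have "\<dots> \<le> real n powr (-\<sigma>)"
    using n assms by (intro powr_mono2') auto
  finally have "exp (-\<sigma>) ^ Suc m * (primepow_weight n / real n)
      \<le> real n powr (-\<sigma>) * (primepow_weight n / real n)"
    by (intro mult_right_mono divide_nonneg_nonneg primepow_weight_nonneg) auto
  also have "\<dots> = primepow_weight n * real n powr (-(1 + \<sigma>))"
    using n powr_add[of "real n" "-1" "-\<sigma>"] by (simp add: powr_minus divide_inverse)
  finally show "exp (-\<sigma>) ^ Suc m * (primepow_weight n / real n)
      \<le> primepow_weight n * real n powr (-(1 + \<sigma>))" .
qed

lemma powser_exp_block_sum_le:
  assumes "0 < r" "r < 1" "summable (\<lambda>m. (exp_block_sum m - 1 / real (Suc m)) * r ^ m)"
  shows "r * (\<Sum>m. (exp_block_sum m - 1 / real (Suc m)) * r ^ m)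
      \<le> ln (1 + 1 / (- ln r)) + ln (1 - r)"
proof (rule LIMSEQ_le)
  define \<sigma> where "\<sigma> = - ln r"
  have \<sigma>: "\<sigma> > 0" "r = exp (-\<sigma>)" using assms by (simp_all add: \<sigma>_def)
  show "(\<lambda>M. r * (\<Sum>m<M. (exp_block_sum m - 1 / real (Suc m)) * r ^ m))
      \<longlonglongrightarrow> r * (\<Sum>m. (exp_block_sum m - 1 / real (Suc m)) * r ^ m)"
    by (intro tendsto_mult tendsto_const summable_LIMSEQ assms(3))
  have "(\<lambda>m. r ^ m / real m) sums (- ln (1 - r))"
    using sums_minus[OF ln_series'[of "-r"]] assms by simp
  then have "(\<lambda>m. r ^ Suc m / real (Suc m)) sums (- ln (1 - r))"
    by (subst sums_Suc_iff) simp
  then show "(\<lambda>M. ln (1 + 1 / (- ln r)) - (\<Sum>m<M. r ^ Suc m / real (Suc m)))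
      \<longlonglongrightarrow> ln (1 + 1 / (- ln r)) + ln (1 - r)"
    unfolding sums_def using tendsto_diff[OF tendsto_const] by fastforce
  have "r * (\<Sum>m<M. (exp_block_sum m - 1 / real (Suc m)) * r ^ m)
      \<le> ln (1 + 1 / (- ln r)) - (\<Sum>m<M. r ^ Suc m / real (Suc m))" for M
  proof -
    have "(\<Sum>m<M. r ^ Suc m * exp_block_sum m)
        \<le> (\<Sum>n\<in>{floor_exp 0<..floor_exp M}. primepow_weight n * real n powr (-(1 + \<sigma>)))"
      unfolding sum_consecutive_intervals[OF mono_floor_exp, symmetric] \<sigma>(2)
      by (intro sum_mono power_mult_exp_block_sum_le \<sigma>)
    also have "\<dots> \<le> (\<Sum>n. primepow_weight n * real n powr (-(1 + \<sigma>)))"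
      using \<sigma>(1)
      by (intro sum_le_suminf summable_primepow_weight_powr) (auto simp: primepow_weight_nonneg)
    also have "\<dots> \<le> ln (1 + 1 / \<sigma>)" by (rule suminf_primepow_weight_powr_le[OF \<sigma>(1)])
    finally have "(\<Sum>m<M. r ^ Suc m * exp_block_sum m) \<le> ln (1 + 1 / (- ln r))" by (simp add: \<sigma>_def)
    moreover have "r * (\<Sum>m<M. (exp_block_sum m - 1 / real (Suc m)) * r ^ m)
        = (\<Sum>m<M. r ^ Suc m * exp_block_sum m) - (\<Sum>m<M. r ^ Suc m / real (Suc m))"
      unfolding sum_distrib_left sum_subtractf[symmetric]
      by (intro sum.cong) (auto simp: left_diff_distrib right_diff_distrib)
    ultimately show ?thesis by simp
  qed
  then show "\<exists>M0. \<forall>M\<ge>M0. r * (\<Sum>m<M. (exp_block_sum m - 1 / real (Suc m)) * r ^ m)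
      \<le> ln (1 + 1 / (- ln r)) - (\<Sum>m<M. r ^ Suc m / real (Suc m))" by blast
qed

lemma exp_block_sum_minus_inverse_sums:
  assumes "(\<lambda>n. primepow_harm n - ln (ln (real n))) \<longlonglongrightarrow> C"
  shows "(\<lambda>m. exp_block_sum m - 1 / real (Suc m)) sums (C - euler_mascheroni)"
proof -
  have "(\<lambda>M. primepow_harm (floor_exp M) - ln (ln (real (floor_exp M)))
      + (ln (ln (real (floor_exp M))) - ln (real M)) - (harm M - ln (real M)))
      \<longlonglongrightarrow> C + 0 - euler_mascheroni"
    by (intro tendsto_intros filterlim_compose[OF assms filterlim_floor_exp]
      ln_ln_floor_exp_tendsto euler_mascheroni_LIMSEQ)
  moreover have "(\<Sum>m<M. 1 / real (Suc m)) = harm M" for M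
    by (induction M) (auto simp: harm_def harm_Suc inverse_eq_divide)
  ultimately show ?thesis
    unfolding sums_def sum_subtractf sum_exp_block_sum by simp
qed

text \<open>Abel summation over the blocks \<open>(e\<^sup>m, e\<^sup>m\<^sup>+\<^sup>1]\<close> compares the limit with \<open>ln \<zeta>(1 + \<sigma>) - ln (1 / \<sigma>)\<close>.\<close>

theorem primepow_harm_minus_ln_ln_limit_le:
  assumes "(\<lambda>n. primepow_harm n - ln (ln (real n))) \<longlonglongrightarrow> C"
  shows "C \<le> euler_mascheroni"
proof -
  define c where "c m = exp_block_sum m - 1 / real (Suc m)" for m
  have c: "summable c" "(\<Sum>m. c m) = C - euler_mascheroni"
    using exp_block_sum_minus_inverse_sums[OF assms] unfolding c_def sums_iff by auto
  have "1 * (\<Sum>m. c m) \<le> 0"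
  proof (rule tendsto_le)
    show "((\<lambda>r. r * (\<Sum>m. c m * r ^ m)) \<longlongrightarrow> 1 * (\<Sum>m. c m)) (at_left 1)"
      using Abel_limit_theorem[OF c(1)] by (intro tendsto_mult tendsto_ident_at) simp
    show "((\<lambda>r::real. ln (1 + 1 / (- ln r)) + ln (1 - r)) \<longlongrightarrow> 0) (at_left 1)" by real_asymp
    have "\<forall>\<^sub>F r in at_left 1. r \<in> {0<..<1::real}"
      by (rule eventually_at_left_real) auto
    then show "\<forall>\<^sub>F r in at_left 1. r * (\<Sum>m. c m * r ^ m) \<le> ln (1 + 1 / (- ln r)) + ln (1 - r)"
    proof eventually_elim
      case (elim r)
      have "summable (\<lambda>m. c m * r ^ m)"
        using powser_inside[of c 1 r] c(1) elim by simp
      then show ?case using elim unfolding c_def by (intro powser_exp_block_sum_le) auto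
    qed
  qed auto
  then show ?thesis using c(2) by simp
qed

corollary eventually_primepow_harm_less:
  assumes "c > euler_mascheroni"
  shows "\<forall>\<^sub>F n in sequentially. primepow_harm n < ln (ln (real n)) + c"
proof -
  obtain C where C: "(\<lambda>n. primepow_harm n - ln (ln (real n))) \<longlonglongrightarrow> C"
    using convergent_primepow_harm by (auto simp: convergent_def)
  have "C < c" using primepow_harm_minus_ln_ln_limit_le[OF C] assms by simp
  from order_tendstoD(2)[OF C this] show ?thesis by eventually_elim simp
qed

section \<open>Dirichlet series with bounded partial sums\<close>

lemma norm_of_nat_powr: "norm (of_nat n powr s :: complex) = real n powr Re s"
  by (cases "n = 0") (auto simp: norm_powr_real_powr)

lemma of_nat_mult_powr: "of_nat (m * n) powr s = of_nat m powr s * (of_nat n powr s :: complex)"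
  by (simp add: powr_times_real)

lemma norm_powr_diff_le:
  assumes "n \<ge> 1" "Re s \<ge> 0"
  shows "norm (of_nat n powr (-s) - of_nat (Suc n) powr (-s) :: complex)
      \<le> norm s * real n powr (-(1 + Re s))"
proof -
  let ?S = "closed_segment (complex_of_real (real n)) (complex_of_real (real n + 1))"
  have segment: "\<exists>u. z = of_real u \<and> real n \<le> u" if "z \<in> ?S" for z
    using that unfolding closed_segment_of_real by (auto simp: closed_segment_eq_real_ivl)
  have "norm (complex_of_real (real n) powr (-s) - complex_of_real (real n + 1) powr (-s))
      \<le> (norm s * real n powr (-(1 + Re s)))
        * norm (complex_of_real (real n) - complex_of_real (real n + 1))"
  proof (rule field_differentiable_bound[of ?S])
    fix z assume "z \<in> ?S"
    then obtain u where u: "z = of_real u" "real n \<le> u" using segment by blast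
    then have u_pos: "u > 0" using assms by simp
    then show "((\<lambda>z. z powr (-s)) has_field_derivative (-s) * z powr (-s - 1)) (at z within ?S)"
      unfolding u
      by (intro has_field_derivative_powr has_field_derivative_at_within)
        (auto simp: complex_nonpos_Reals_iff)
    have "norm (z powr (-s - 1)) = u powr (- Re s - 1)"
      using u_pos unfolding u by (subst norm_powr_real_powr) auto
    also have "\<dots> \<le> real n powr (-(1 + Re s))"
      using u assms by (intro order.trans[OF powr_mono2' powr_mono]) auto
    finally show "norm ((-s) * z powr (-s - 1)) \<le> norm s * real n powr (-(1 + Re s))"
      by (simp add: norm_mult mult_left_mono)
  qed auto
  also have "norm (complex_of_real (real n) - complex_of_real (real n + 1)) = 1"
    by simp
  finally show ?thesis by (simp add: add.commute)
qed

lemma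
  assumes "Re s > 0"
  shows summable_norm_powr_diff:
      "summable (\<lambda>n. norm (of_nat (Suc n) powr (-s) - of_nat (Suc (Suc n)) powr (-s) :: complex))"
    and suminf_norm_powr_diff_le:
      "(\<Sum>n. norm (of_nat (Suc n) powr (-s) - of_nat (Suc (Suc n)) powr (-s) :: complex))
          \<le> norm s * (1 + 1 / Re s)"
proof -
  let ?b = "\<lambda>n. norm (of_nat (Suc n) powr (-s) - of_nat (Suc (Suc n)) powr (-s) :: complex)"
  have term_le: "?b n \<le> norm s * real (Suc n) powr (-(1 + Re s))" for n
    using norm_powr_diff_le[of "Suc n" s] assms by simp
  have majorant: "summable (\<lambda>n. real (Suc n) powr (-(1 + Re s)))"
    using summable_powr[OF assms] by (subst summable_Suc_iff)
  show "summable ?b"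
    by (rule summable_comparison_test'[OF summable_mult[OF majorant], of 0]) (use term_le in auto)
  then have "(\<Sum>n. ?b n) \<le> (\<Sum>n. norm s * real (Suc n) powr (-(1 + Re s)))"
    by (intro suminf_le term_le summable_mult majorant)
  also have "\<dots> = norm s * (\<Sum>n. real n powr (-(1 + Re s)))"
    using suminf_split_head[OF summable_powr[OF assms]]
    by (simp only: suminf_mult[OF majorant]) simp
  also have "\<dots> \<le> norm s * (1 + 1 / Re s)"
    by (intro mult_left_mono suminf_powr_le assms) simp
  finally show "(\<Sum>n. ?b n) \<le> norm s * (1 + 1 / Re s)" .
qed

text \<open>The value \<open>a 0\<close> is irrelevant: the term \<open>n = 0\<close> of \<open>dirichlet_L\<close> is \<open>a 0 / 0 = 0\<close>.\<close>

locale bounded_partial_sums =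
  fixes a :: "nat \<Rightarrow> complex" and B :: real
  assumes norm_partial_sum_le: "norm (\<Sum>j\<le>n. a (Suc j)) \<le> B"
begin

definition by_parts_term :: "nat \<Rightarrow> complex \<Rightarrow> complex" where
  "by_parts_term n s
      = (\<Sum>j\<le>n. a (Suc j)) * (of_nat (Suc n) powr (-s) - of_nat (Suc (Suc n)) powr (-s))"

lemma
  assumes "Re s > 0"
  shows dirichlet_L_by_parts: "dirichlet_L a s = (\<Sum>n. by_parts_term n s)"
    and norm_dirichlet_L_le: "norm (dirichlet_L a s) \<le> B * (norm s * (1 + 1 / Re s))"
proof -
  have "(\<lambda>n. norm (of_nat (Suc n) powr (-s) :: complex)) \<longlonglongrightarrow> 0"
    unfolding norm_of_nat_powr using assms by real_asymp
  then have lim: "(\<lambda>n. of_nat (Suc n) powr (-s) :: complex) \<longlonglongrightarrow> 0" by (rule tendsto_norm_zero_cancel)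
  note test = Dirichlet_test[OF norm_partial_sum_le lim summable_norm_powr_diff[OF assms]]
  have sums: "(\<lambda>n. a (Suc n) * of_nat (Suc n) powr (-s)) sums (\<Sum>n. by_parts_term n s)"
    using test(1) unfolding by_parts_term_def .
  then have "(\<lambda>n. a n / of_nat n powr s) sums (\<Sum>n. by_parts_term n s)"
    by (subst sums_Suc_iff[symmetric, where f = "\<lambda>n. a n / of_nat n powr s", simplified])
      (simp add: powr_minus divide_inverse)
  then show eq: "dirichlet_L a s = (\<Sum>n. by_parts_term n s)"
    by (simp add: dirichlet_L_def sums_iff)
  have "B \<ge> 0" using order.trans[OF norm_ge_zero norm_partial_sum_le] .
  then show "norm (dirichlet_L a s) \<le> B * (norm s * (1 + 1 / Re s))"
    using order.trans[OF test(2) mult_left_mono[OF suminf_norm_powr_diff_le[OF assms]]] sums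
    by (simp add: eq sums_iff)
qed

lemma norm_by_parts_term_le:
  assumes "0 < \<delta>" "\<delta> \<le> Re s" "norm s \<le> R"
  shows "norm (by_parts_term n s) \<le> B * (R * real (Suc n) powr (-(1 + \<delta>)))"
proof -
  have "norm (of_nat (Suc n) powr (-s) - of_nat (Suc (Suc n)) powr (-s) :: complex)
      \<le> norm s * real (Suc n) powr (-(1 + Re s))"
    using assms by (intro norm_powr_diff_le) auto
  also have "\<dots> \<le> R * real (Suc n) powr (-(1 + \<delta>))"
    using assms order.trans[OF norm_ge_zero assms(3)] by (intro mult_mono powr_mono) auto
  finally show ?thesis
    unfolding by_parts_term_def norm_mult
    by (intro mult_mono norm_partial_sum_le)
      (use order.trans[OF norm_ge_zero norm_partial_sum_le] in auto)
qed

lemma holomorphic_dirichlet_L: "dirichlet_L a holomorphic_on {s. Re s > 0}"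
proof -
  have "(\<lambda>s. \<Sum>n. by_parts_term n s) holomorphic_on {s. Re s > 0}"
  proof (rule holomorphic_uniform_sequence[OF open_halfspace_Re_gt])
    show "(\<lambda>s. \<Sum>k<n. by_parts_term k s) holomorphic_on {s. Re s > 0}" for n
      unfolding by_parts_term_def by (intro holomorphic_intros)
    fix x assume "x \<in> {s. Re s > 0}"
    then have x: "Re x > 0" by simp
    define d where "d = Re x / 2"
    have d: "d > 0" using x by (simp add: d_def)
    have ball: "d \<le> Re s" "norm s \<le> norm x + d" if "s \<in> cball x d" for s
      using that abs_Re_le_cmod[of "x - s"] norm_triangle_sub[of s x]
      by (auto simp: d_def dist_norm norm_minus_commute)
    have "uniform_limit (cball x d) (\<lambda>n s. \<Sum>k<n. by_parts_term k s)
        (\<lambda>s. \<Sum>n. by_parts_term n s) sequentially"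
    proof (rule Weierstrass_m_test)
      show "norm (by_parts_term n s) \<le> B * ((norm x + d) * real (Suc n) powr (-(1 + d)))"
          if "s \<in> cball x d" for n s
        using norm_by_parts_term_le[OF d ball[OF that]] .
      have "summable (\<lambda>n. real (Suc n) powr (-(1 + d)))"
        using summable_powr[OF d] by (subst summable_Suc_iff)
      then show "summable (\<lambda>n. B * ((norm x + d) * real (Suc n) powr (-(1 + d))))"
        by (intro summable_mult)
    qed
    moreover have "cball x d \<subseteq> {s. Re s > 0}" using ball(1) d by fastforce
    ultimately show "\<exists>d>0. cball x d \<subseteq> {s. Re s > 0} \<and>
        uniform_limit (cball x d) (\<lambda>n s. \<Sum>k<n. by_parts_term k s)
            (\<lambda>s. \<Sum>n. by_parts_term n s) sequentially"
      using d by blast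
  qed
  then show ?thesis
    by (rule holomorphic_transform) (simp add: dirichlet_L_by_parts)
qed

end

section \<open>Dirichlet characters\<close>

locale dirichlet_character =
  fixes q :: nat and chi :: "nat \<Rightarrow> complex"
  assumes dirichlet_char: "dirichlet_char q chi"
begin

lemma chi_mult: "chi (m * n) = chi m * chi n"
  and chi_add_q: "chi (n + q) = chi n"
  and chi_eq_0_iff: "chi n = 0 \<longleftrightarrow> \<not> coprime n q"
  and q_pos: "q > 0"
  using dirichlet_char unfolding dirichlet_char_def by auto

lemma chi_1: "chi 1 = 1"
  using chi_mult[of 1 1] chi_eq_0_iff[of 1] by simp

lemma chi_power: "chi (n ^ k) = chi n ^ k"
  using chi_1 by (induction k) (auto simp: chi_mult)

lemma chi_mod_q: "chi (n mod q) = chi n"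
proof -
  have "chi (m + k * q) = chi m" for m k
    by (induction k) (use chi_add_q[of "m + k * q" for k] in \<open>auto simp: add_ac\<close>)
  from this[of "n mod q" "n div q"] show ?thesis by simp
qed

lemma norm_chi: "norm (chi n) = (if coprime n q then 1 else 0)"
proof (cases "coprime n q")
  case True
  then have "chi (n ^ totient q) = chi 1"
    using chi_mod_q euler_theorem[of n q] by (metis cong_def)
  then have "norm (chi n) ^ totient q = 1" using chi_1 by (simp add: chi_power flip: norm_power)
  then show ?thesis using True q_pos power_eq_imp_eq_base[of "norm (chi n)" "totient q" 1] by simp
qed (simp add: chi_eq_0_iff)

lemma norm_chi_le_1: "norm (chi n) \<le> 1"
  by (simp add: norm_chi)

lemma dirichlet_char_square: "dirichlet_char q (\<lambda>n. chi n ^ 2)"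
  unfolding dirichlet_char_def
  using q_pos chi_mult chi_add_q chi_eq_0_iff by (auto simp: power_mult_distrib)

definition logL_term :: "nat \<Rightarrow> complex \<Rightarrow> complex" where
  "logL_term n s = of_real (primepow_weight n) * (chi n * of_nat n powr (-s))"

lemma norm_logL_term_le: "norm (logL_term n s) \<le> primepow_weight n * real n powr (- Re s)"
proof -
  have "norm (chi n) * real n powr (- Re s) \<le> real n powr (- Re s)"
    using norm_chi_le_1[of n] by (simp add: mult_left_le_one_le)
  then show ?thesis
    unfolding logL_term_def norm_mult norm_of_nat_powr
    by (simp add: primepow_weight_nonneg mult_left_mono)
qed

lemma
  assumes "Re s > 1"
  shows summable_logL_term: "summable (\<lambda>n. norm (logL_term n s))"
    and exp_suminf_logL_term: "exp (\<Sum>n. logL_term n s) = dirichlet_L chi s"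
proof -
  have "summable (\<lambda>n. real n powr (- Re s))"
    using assms by (subst summable_real_powr_iff) auto
  then have summable: "summable (\<lambda>n. norm (chi n * of_nat n powr (-s)))"
    by (rule summable_comparison_test'[of _ 0])
      (auto simp: norm_mult norm_of_nat_powr norm_chi_le_1 intro!: mult_left_le_one_le)
  then show "summable (\<lambda>n. norm (logL_term n s))"
    unfolding logL_term_def by (rule summable_primepow_weight_mult)
  interpret summable_completely_multiplicative "\<lambda>n. chi n * of_nat n powr (-s)"
    by unfold_locales
      (use summable chi_1 chi_mult in \<open>auto simp: of_nat_mult_powr mult_ac simp del: of_nat_mult\<close>)
  show "exp (\<Sum>n. logL_term n s) = dirichlet_L chi s"
    using exp_suminf_primepow_weight
    by (simp add: logL_term_def dirichlet_L_def powr_minus divide_inverse)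
qed

end

locale nonprincipal_character = dirichlet_character +
  assumes not_principal: "\<not> principal_char q chi"
begin

lemma q_gt_1: "q > 1"
proof (rule ccontr)
  assume "\<not> q > 1"
  then have "q = 1" using q_pos by simp
  then have "chi n = 1" for n
    using chi_mod_q[of n] chi_mod_q[of 1] chi_1 by simp
  then show False using not_principal \<open>q = 1\<close> by (simp add: principal_char_def)
qed

lemma chi_0: "chi 0 = 0"
  using q_gt_1 by (simp add: chi_eq_0_iff)

lemma sum_chi_period: "(\<Sum>n<q. chi n) = 0"
proof -
  obtain a where a: "coprime a q" "chi a \<noteq> 1"
    using not_principal chi_eq_0_iff unfolding principal_char_def by metis
  have "inj_on (\<lambda>n. a * n mod q) {..<q}"
  proof (rule inj_onI)
    fix x y assume xy: "x \<in> {..<q}" "y \<in> {..<q}" "a * x mod q = a * y mod q"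
    then have "[x = y] (mod q)" using a by (simp add: cong_def[symmetric] cong_mult_lcancel_nat)
    then show "x = y" using xy by (simp add: cong_def)
  qed
  moreover from this have "(\<lambda>n. a * n mod q) ` {..<q} = {..<q}"
    using q_pos by (intro endo_inj_surj) auto
  ultimately have "(\<Sum>n<q. chi n) = (\<Sum>n<q. chi (a * n mod q))"
    by (metis (no_types, lifting) sum.reindex_cong)
  also have "\<dots> = chi a * (\<Sum>n<q. chi n)"
    by (simp add: chi_mod_q chi_mult sum_distrib_left)
  finally show ?thesis using a by simp
qed

lemma norm_sum_chi_le: "norm (\<Sum>j<n. chi j) \<le> real q"
proof (induction n rule: less_induct)
  case (less n)
  show ?case
  proof (cases "n < q")
    case True
    have "norm (\<Sum>j<n. chi j) \<le> (\<Sum>j<n. 1)"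
      by (intro sum_norm_le norm_chi_le_1)
    then show ?thesis using True by simp
  next
    case False
    have "(\<Sum>j<q + m. chi j) = (\<Sum>j<m. chi j)" for m
      by (induction m) (use sum_chi_period chi_add_q in \<open>auto simp: add.commute\<close>)
    from this[of "n - q"] show ?thesis using False less[of "n - q"] q_pos by simp
  qed
qed

sublocale bounded_partial_sums chi "real q"
proof
  show "norm (\<Sum>j\<le>n. chi (Suc j)) \<le> real q" for n
    using norm_sum_chi_le[of "Suc (Suc n)"] chi_0 unfolding sum.lessThan_Suc_shift[of _ "Suc n"]
    by (simp add: lessThan_Suc_atMost)
qed

end

section \<open>Non-vanishing on the line \<open>Re s = 1\<close>\<close>

lemma three_plus_four_Re_plus_Re_square_nonneg:
  fixes w :: complex
  assumes "norm w \<le> 1"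
  shows "3 + 4 * Re w + Re (w ^ 2) \<ge> 0"
proof -
  have "(Re w)\<^sup>2 + (Im w)\<^sup>2 \<le> 1" using assms by (simp add: cmod_def)
  moreover have "2 * (1 + Re w)\<^sup>2 \<ge> 0" by simp
  ultimately show ?thesis by (simp add: power2_eq_square algebra_simps)
qed

context dirichlet_character
begin

lemma logL_term_Complex:
  "logL_term n (Complex \<sigma> t) = of_real (primepow_weight n * real n powr (-\<sigma>))
      * (chi n * of_nat n powr (- (\<i> * of_real t)))"
proof -
  have "- Complex \<sigma> t = of_real (-\<sigma>) + (- (\<i> * of_real t))"
    by (simp add: complex_eq_iff)
  then have "of_nat n powr (- Complex \<sigma> t)
      = of_nat n powr of_real (-\<sigma>) * of_nat n powr (- (\<i> * of_real t))"
    by (simp only: powr_add)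
  moreover have "(of_nat n powr of_real (-\<sigma>) :: complex) = of_real (real n powr (-\<sigma>))"
    using powr_of_real[of "real n" "-\<sigma>"] by simp
  ultimately show ?thesis by (simp add: logL_term_def)
qed

interpretation square: dirichlet_character q "\<lambda>n. chi n ^ 2"
  by unfold_locales (rule dirichlet_char_square)

lemma logL_341_nonneg:
  assumes "\<sigma> > 0"
  shows "0 \<le> 3 * (\<Sum>n. primepow_weight n * real n powr (-(1 + \<sigma>)))
      + 4 * Re (\<Sum>n. logL_term n (Complex (1 + \<sigma>) t))
      + Re (\<Sum>n. square.logL_term n (Complex (1 + \<sigma>) (2 * t)))"
proof -
  define c where "c n = primepow_weight n * real n powr (-(1 + \<sigma>))" for n
  define z where "z n = chi n * of_nat n powr (- (\<i> * of_real t))" for n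
  have "norm (z n) \<le> 1" for n
    by (cases "n = 0") (auto simp: z_def norm_mult norm_of_nat_powr norm_chi_le_1)
  then have pos: "0 \<le> c n * (3 + 4 * Re (z n) + Re (z n ^ 2))" for n
    unfolding c_def
    by (intro mult_nonneg_nonneg three_plus_four_Re_plus_Re_square_nonneg primepow_weight_nonneg) auto
  have first: "logL_term n (Complex (1 + \<sigma>) t) = of_real (c n) * z n" for n
    unfolding logL_term_Complex c_def z_def ..
  have "of_nat n powr (- (\<i> * of_real (2 * t)))
      = (of_nat n powr (- (\<i> * of_real t)) :: complex) ^ 2" for n
    unfolding power2_eq_square powr_add[symmetric] by (simp add: algebra_simps)
  then have second: "square.logL_term n (Complex (1 + \<sigma>) (2 * t)) = of_real (c n) * z n ^ 2" for n
    by (simp only: square.logL_term_Complex c_def z_def power_mult_distrib)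
  have "c sums (\<Sum>n. c n)"
    unfolding c_def by (rule summable_sums[OF summable_primepow_weight_powr[OF assms]])
  moreover have "(\<lambda>n. of_real (c n) * z n) sums (\<Sum>n. of_real (c n) * z n)"
    using summable_logL_term[of "Complex (1 + \<sigma>) t"] assms
    by (auto simp: first dest: summable_norm_cancel intro: summable_sums)
  moreover have "(\<lambda>n. of_real (c n) * z n ^ 2) sums (\<Sum>n. of_real (c n) * z n ^ 2)"
    using square.summable_logL_term[of "Complex (1 + \<sigma>) (2 * t)"] assms
    by (auto simp: second dest: summable_norm_cancel intro: summable_sums)
  ultimately have "(\<lambda>n. 3 * c n + 4 * Re (of_real (c n) * z n) + Re (of_real (c n) * z n ^ 2)) sums
      (3 * (\<Sum>n. c n) + 4 * Re (\<Sum>n. of_real (c n) * z n) + Re (\<Sum>n. of_real (c n) * z n ^ 2))"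
    by (intro sums_add sums_mult sums_Re)
  then show ?thesis
    unfolding first second c_def[symmetric]
    by (rule sums_le[OF _ sums_zero, rotated]) (use pos in \<open>simp add: algebra_simps\<close>)
qed

lemma one_le_341_product:
  assumes \<sigma>: "\<sigma> > 0"
  shows "1 \<le> (1 + 1 / \<sigma>) ^ 3 * norm (dirichlet_L chi (Complex (1 + \<sigma>) t)) ^ 4 *
             norm (dirichlet_L (\<lambda>n. chi n ^ 2) (Complex (1 + \<sigma>) (2 * t)))"
proof -
  let ?Z = "\<Sum>n. primepow_weight n * real n powr (-(1 + \<sigma>))"
    and ?X = "Re (\<Sum>n. logL_term n (Complex (1 + \<sigma>) t))"
    and ?Y = "Re (\<Sum>n. square.logL_term n (Complex (1 + \<sigma>) (2 * t)))"
  have "1 \<le> exp (3 * ?Z + 4 * ?X + ?Y)" using logL_341_nonneg[OF \<sigma>] by simp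
  also have "\<dots> \<le> exp (3 * ln (1 + 1 / \<sigma>) + 4 * ?X + ?Y)"
    using suminf_primepow_weight_powr_le[OF \<sigma>] by simp
  also have "\<dots> = exp (ln (1 + 1 / \<sigma>)) ^ 3 * exp ?X ^ 4 * exp ?Y"
    by (simp add: exp_add flip: exp_of_nat_mult)
  also have "exp (ln (1 + 1 / \<sigma>)) = 1 + 1 / \<sigma>" using \<sigma> by (simp add: add_pos_pos)
  also have "exp ?X = norm (dirichlet_L chi (Complex (1 + \<sigma>) t))"
    using \<sigma> exp_suminf_logL_term[of "Complex (1 + \<sigma>) t"] by (simp flip: norm_exp_eq_Re)
  also have "exp ?Y = norm (dirichlet_L (\<lambda>n. chi n ^ 2) (Complex (1 + \<sigma>) (2 * t)))"
    using \<sigma> square.exp_suminf_logL_term[of "Complex (1 + \<sigma>) (2 * t)"] by (simp flip: norm_exp_eq_Re)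
  finally show ?thesis .
qed

end

lemma has_field_derivative_imp_quotient_tendsto_at_right:
  fixes f :: "complex \<Rightarrow> complex"
  assumes "(f has_field_derivative D) (at z)" "f z = 0"
  shows "((\<lambda>\<sigma>. f (z + of_real \<sigma>) / of_real \<sigma>) \<longlongrightarrow> D) (at_right (0::real))"
proof -
  have "((\<lambda>h. f (z + h) / h) \<longlongrightarrow> D) (at 0)"
    using assms unfolding DERIV_def by simp
  moreover have "filterlim complex_of_real (at 0) (at_right 0)"
    by (auto simp: filterlim_at eventually_at_filter intro!: tendsto_eq_intros)
  ultimately show ?thesis by (rule filterlim_compose)
qed

lemma (in nonprincipal_character) dirichlet_L_nonzero_line_1:
  assumes "\<not> principal_char q (\<lambda>n. chi n ^ 2)"
  shows "dirichlet_L chi (Complex 1 t) \<noteq> 0"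
proof
  assume zero: "dirichlet_L chi (Complex 1 t) = 0"
  interpret square: nonprincipal_character q "\<lambda>n. chi n ^ 2"
    by unfold_locales (use dirichlet_char_square assms in auto)
  define K where "K = real q * ((2 + \<bar>2 * t\<bar>) * 2)"
  obtain D where "(dirichlet_L chi has_field_derivative D) (at (Complex 1 t))"
    using holomorphic_on_imp_differentiable_at[OF holomorphic_dirichlet_L open_halfspace_Re_gt,
        of "Complex 1 t"]
    by (auto simp: field_differentiable_def)
  from has_field_derivative_imp_quotient_tendsto_at_right[OF this zero]
  have lim: "((\<lambda>\<sigma>. 8 * \<sigma> * norm (dirichlet_L chi (Complex 1 t + of_real \<sigma>) / of_real \<sigma>) ^ 4 * K)
      \<longlongrightarrow> 8 * 0 * norm D ^ 4 * K) (at_right 0)"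
    by (intro tendsto_intros)
  have "1 \<le> 8 * \<sigma> * norm (dirichlet_L chi (Complex 1 t + of_real \<sigma>) / of_real \<sigma>) ^ 4 * K"
    if \<sigma>: "0 < \<sigma>" "\<sigma> < 1" for \<sigma>
  proof -
    let ?L = "norm (dirichlet_L chi (Complex (1 + \<sigma>) t))"
      and ?L2 = "norm (dirichlet_L (\<lambda>n. chi n ^ 2) (Complex (1 + \<sigma>) (2 * t)))"
    have "?L2 \<le> real q * (norm (Complex (1 + \<sigma>) (2 * t)) * (1 + 1 / (1 + \<sigma>)))"
      using \<sigma> square.norm_dirichlet_L_le[of "Complex (1 + \<sigma>) (2 * t)"] by simp
    also have "\<dots> \<le> K"
      unfolding K_def using cmod_le[of "Complex (1 + \<sigma>) (2 * t)"] \<sigma>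
      by (intro mult_left_mono mult_mono) auto
    finally have L2: "?L2 \<le> K" .
    have "1 \<le> (1 + 1 / \<sigma>) ^ 3 * ?L ^ 4 * ?L2" by (rule one_le_341_product[OF \<sigma>(1)])
    also have "\<dots> \<le> (2 / \<sigma>) ^ 3 * ?L ^ 4 * K"
      using \<sigma> L2 by (intro mult_mono power_mono) (auto simp: field_simps)
    also have "\<dots> = 8 * \<sigma> * (?L / \<sigma>) ^ 4 * K"
      using \<sigma> by (simp add: field_simps power_divide eval_nat_numeral)
    also have "Complex (1 + \<sigma>) t = Complex 1 t + of_real \<sigma>" by (simp add: complex_eq_iff)
    finally show ?thesis using \<sigma> by (simp add: norm_divide)
  qed
  then have "(1::real) \<le> 8 * 0 * norm D ^ 4 * K"
    by (intro tendsto_lowerbound[OF lim] eventually_mono[OF eventually_at_right_real[of 0 1]]) auto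
  then show False by simp
qed

theorem (in nonprincipal_character) dirichlet_L_nonzero:
  assumes GRH "\<not> principal_char q (\<lambda>n. chi n ^ 2)" "Re s > 1/2"
  shows "dirichlet_L chi s \<noteq> 0"
proof -
  consider "Re s < 1" | "Re s = 1" | "Re s > 1" by linarith
  then show ?thesis
  proof cases
    case 1
    then show ?thesis using assms dirichlet_char not_principal unfolding GRH_def by blast
  next
    case 2
    then have "s = Complex 1 (Im s)" by (simp add: complex_eq_iff)
    then show ?thesis using dirichlet_L_nonzero_line_1[OF assms(2), of "Im s"] by simp
  next
    case 3
    then show ?thesis using exp_suminf_logL_term[of s] by (metis exp_not_eq_zero)
  qed
qed

section \<open>The logarithm of the L-function\<close>

lemma exp_eq_imp_diff_constant_on:
  fixes f g :: "'a::topological_space \<Rightarrow> complex"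
  assumes "connected S" "continuous_on S f" "continuous_on S g"
    and eq: "\<And>x. x \<in> S \<Longrightarrow> exp (f x) = exp (g x)"
  shows "(\<lambda>x. f x - g x) constant_on S"
proof (rule continuous_discrete_range_constant[OF assms(1) continuous_on_diff[OF assms(2,3)]])
  fix x assume x: "x \<in> S"
  have "1 \<le> norm ((f y - g y) - (f x - g x))" if y: "y \<in> S" "f y - g y \<noteq> f x - g x" for y
  proof -
    have "exp (f y - g y) = exp (f x - g x)" using x y eq by (simp add: exp_diff)
    then obtain n :: int where n: "f y - g y = (f x - g x) + of_int (2 * n) * of_real pi * \<i>"
      by (auto simp: exp_eq)
    then have "n \<noteq> 0" using y by auto
    have "1 * 1 \<le> \<bar>2 * real_of_int n\<bar> * pi"
      using \<open>n \<noteq> 0\<close> pi_gt3 by (intro mult_mono) auto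
    also have "\<dots> = norm ((f y - g y) - (f x - g x))" using n by (simp add: norm_mult)
    finally show ?thesis by simp
  qed
  then show "\<exists>e>0. \<forall>y. y \<in> S \<and> f y - g y \<noteq> f x - g x \<longrightarrow> e \<le> norm ((f y - g y) - (f x - g x))"
    by (intro exI[of _ 1]) auto
qed

context dirichlet_character
begin

lemma norm_logL_term_le_powr:
  assumes "Re s \<ge> 1 + \<sigma>"
  shows "norm (logL_term n s) \<le> primepow_weight n * real n powr (-(1 + \<sigma>))"
proof (cases "n = 0")
  case False
  then have "primepow_weight n * real n powr (- Re s) \<le> primepow_weight n * real n powr (-(1 + \<sigma>))"
    using assms by (intro mult_left_mono powr_mono primepow_weight_nonneg) auto
  then show ?thesis using norm_logL_term_le[of n s] by linarith
qed (simp add: logL_term_def)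

lemma norm_suminf_logL_term_le:
  assumes "\<sigma> > 0" "Re s \<ge> 1 + \<sigma>"
  shows "norm (\<Sum>n. logL_term n s) \<le> ln (1 + 1 / \<sigma>)"
proof -
  have summable: "summable (\<lambda>n. norm (logL_term n s))"
    using assms by (intro summable_logL_term) auto
  have "norm (\<Sum>n. logL_term n s) \<le> (\<Sum>n. norm (logL_term n s))" by (rule summable_norm[OF summable])
  also have "\<dots> \<le> (\<Sum>n. primepow_weight n * real n powr (-(1 + \<sigma>)))"
    using assms by (intro suminf_le norm_logL_term_le_powr summable summable_primepow_weight_powr)
  also have "\<dots> \<le> ln (1 + 1 / \<sigma>)" by (rule suminf_primepow_weight_powr_le[OF assms(1)])
  finally show ?thesis .
qed

lemma continuous_on_suminf_logL_term:
  assumes "\<sigma> > 0"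
  shows "continuous_on {s. Re s \<ge> 1 + \<sigma>} (\<lambda>s. \<Sum>n. logL_term n s)"
proof (rule uniform_limit_theorem)
  show "uniform_limit {s. Re s \<ge> 1 + \<sigma>} (\<lambda>N s. \<Sum>n<N. logL_term n s)
      (\<lambda>s. \<Sum>n. logL_term n s) sequentially"
    by (rule Weierstrass_m_test[OF norm_logL_term_le_powr summable_primepow_weight_powr[OF assms]])
      simp
  have "continuous_on A (logL_term n)" for A n
    unfolding logL_term_def by (cases "n = 0") (auto intro!: continuous_intros)
  then show "\<forall>\<^sub>F N in sequentially. continuous_on {s. Re s \<ge> 1 + \<sigma>} (\<lambda>s. \<Sum>n<N. logL_term n s)"
    by (intro always_eventually allI continuous_on_sum)
qed auto

end

locale L_logarithm = nonprincipal_character +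
  fixes logL :: "complex \<Rightarrow> complex"
  assumes holomorphic_logL: "logL holomorphic_on {s. Re s > 1/2}"
    and exp_logL: "Re s > 1/2 \<Longrightarrow> exp (logL s) = dirichlet_L chi s"
    and logL_eq_suminf: "Re s \<ge> 2 \<Longrightarrow> logL s = (\<Sum>n. logL_term n s)"

theorem (in nonprincipal_character) L_logarithm_exists:
  assumes nonzero: "\<And>s. Re s > 1/2 \<Longrightarrow> dirichlet_L chi s \<noteq> 0"
  obtains logL where "L_logarithm q chi logL"
proof -
  have "contractible {s. Re s > 1/2}"
    by (intro convex_imp_contractible convex_halfspace_Re_gt)
  moreover have "dirichlet_L chi holomorphic_on {s. Re s > 1/2}"
    by (rule holomorphic_on_subset[OF holomorphic_dirichlet_L]) auto
  ultimately obtain g where g: "g holomorphic_on {s. Re s > 1/2}"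
    "\<And>s. Re s > 1/2 \<Longrightarrow> dirichlet_L chi s = exp (g s)"
    using contractible_imp_holomorphic_log[of "dirichlet_L chi"] nonzero by (metis mem_Collect_eq)
  have exp_g: "exp (g s) = exp (\<Sum>n. logL_term n s)" if "Re s \<ge> 2" for s
    using that by (simp add: g(2)[symmetric] exp_suminf_logL_term)
  have "(\<lambda>s. g s - (\<Sum>n. logL_term n s)) constant_on {s. Re s \<ge> 2}"
  proof (rule exp_eq_imp_diff_constant_on)
    show "continuous_on {s. Re s \<ge> 2} g"
      by (rule continuous_on_subset[OF holomorphic_on_imp_continuous_on[OF g(1)]]) auto
    show "continuous_on {s. Re s \<ge> 2} (\<lambda>s. \<Sum>n. logL_term n s)"
      using continuous_on_suminf_logL_term[of 1] by simp
  qed (auto intro: convex_connected convex_halfspace_Re_ge exp_g)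
  then obtain c where c: "g s - (\<Sum>n. logL_term n s) = c" if "Re s \<ge> 2" for s
    by (auto simp: constant_on_def)
  have "exp c = 1" using c[of 2] exp_g[of 2] by (auto simp: exp_diff)
  then have "L_logarithm q chi (\<lambda>s. g s - c)"
    using g c by unfold_locales (auto intro!: holomorphic_intros simp: exp_diff algebra_simps)
  then show ?thesis by (rule that)
qed

lemma Borel_Caratheodory_unit_ball:
  assumes holf: "f holomorphic_on ball 0 1" and zero: "f 0 = 0"
    and Re_less: "\<And>z. norm z < 1 \<Longrightarrow> Re (f z) < A" and z: "norm z < 1"
  shows "norm (f z) \<le> 2 * A * norm z / (1 - norm z)"
proof -
  have A: "A > 0" using Re_less[of 0] zero by simp
  define \<phi> where "\<phi> = (\<lambda>w. f w / (of_real (2 * A) - f w))"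
  have denom: "of_real (2 * A) - f w \<noteq> 0" if "norm w < 1" for w
    using Re_less[OF that] A by (auto simp: complex_eq_iff)
  have \<phi>: "norm (\<phi> z) \<le> norm z"
  proof (rule Schwarz_Lemma)
    show "\<phi> holomorphic_on ball 0 1"
      unfolding \<phi>_def using denom by (intro holomorphic_intros holf) auto
    show "\<phi> 0 = 0" by (simp add: \<phi>_def zero)
    show "norm (\<phi> w) < 1" if w: "norm w < 1" for w
    proof -
      have "norm (of_real (2 * A) - f w) ^ 2 - norm (f w) ^ 2 = 4 * A * (A - Re (f w))"
        by (simp add: cmod_power2) (simp add: power2_eq_square algebra_simps)
      also have "\<dots> > 0" using Re_less[OF w] A by simp
      finally have "norm (f w) < norm (of_real (2 * A) - f w)"
        by (intro power2_less_imp_less[of "norm (f w)"]) auto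
      then show ?thesis using denom[OF w] by (simp add: \<phi>_def norm_divide)
    qed
  qed (use z in auto)
  have "f z * (1 + \<phi> z) = of_real (2 * A) * \<phi> z"
    using denom[OF z] by (simp add: \<phi>_def field_simps)
  then have norm_eq: "norm (f z) * norm (1 + \<phi> z) = 2 * A * norm (\<phi> z)"
    using A by (metis norm_mult norm_of_real abs_of_pos mult_pos_pos zero_less_numeral)
  have "1 - norm z \<le> norm (1 + \<phi> z)"
    using norm_triangle_ineq2[of 1 "- \<phi> z"] \<phi> by simp
  then have "norm (f z) * (1 - norm z) \<le> norm (f z) * norm (1 + \<phi> z)" by (rule mult_left_mono) simp
  also have "\<dots> \<le> 2 * A * norm z" unfolding norm_eq using \<phi> A by simp
  finally show ?thesis using z by (simp add: field_simps)
qed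

theorem Borel_Caratheodory:
  assumes holg: "g holomorphic_on ball c R"
    and Re_less: "\<And>w. w \<in> ball c R \<Longrightarrow> Re (g w - g c) < A" and z: "z \<in> ball c R"
  shows "norm (g z - g c) \<le> 2 * A * dist c z / (R - dist c z)"
proof -
  have R: "R > 0" using z by (metis ball_eq_empty empty_iff not_le)
  define f where "f = (\<lambda>w. g (c + of_real R * w) - g c)"
  have in_ball: "c + of_real R * w \<in> ball c R" if "norm w < 1" for w
    using that R by (simp add: dist_norm norm_mult)
  define w where "w = (z - c) / of_real R"
  have norm_w: "norm w = dist c z / R"
    using R by (simp add: w_def norm_divide dist_norm norm_minus_commute)
  have "norm (f w) \<le> 2 * A * norm w / (1 - norm w)"
  proof (rule Borel_Caratheodory_unit_ball)
    have "(g \<circ> (\<lambda>w. c + of_real R * w)) holomorphic_on ball 0 1"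
      using in_ball by (intro holomorphic_on_compose_gen[OF _ holg] holomorphic_intros) auto
    then show "f holomorphic_on ball 0 1" unfolding f_def o_def by (intro holomorphic_intros)
    show "Re (f u) < A" if "norm u < 1" for u
      unfolding f_def using Re_less[OF in_ball[OF that]] .
    show "norm w < 1" unfolding norm_w using z R by simp
  qed (simp add: f_def)
  moreover have "f w = g z - g c" using R by (simp add: f_def w_def)
  moreover have "2 * A * norm w / (1 - norm w) = 2 * A * dist c z / (R - dist c z)"
    using R z unfolding norm_w by (simp add: field_simps)
  ultimately show ?thesis by simp
qed

context L_logarithm
begin

lemma Re_logL_le:
  assumes "Re s > 1/2"
  shows "Re (logL s) \<le> ln (real q) + 3 * norm s - 1"
proof -
  have s: "norm s > 0" using assms by auto
  have "exp (Re (logL s)) = norm (dirichlet_L chi s)"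
    using exp_logL[OF assms] by (metis norm_exp_eq_Re)
  also have "\<dots> \<le> real q * (norm s * (1 + 1 / Re s))" using assms by (intro norm_dirichlet_L_le) simp
  also have "\<dots> \<le> real q * (norm s * 3)"
    using assms by (intro mult_left_mono) (auto simp: field_simps)
  finally have "Re (logL s) \<le> ln (real q * (norm s * 3))"
    using q_pos s by (subst ln_ge_iff) auto
  also have "\<dots> = ln (real q) + ln (3 * norm s)"
    using q_pos s by (subst ln_mult) (auto simp: mult.commute)
  also have "ln (3 * norm s) \<le> 3 * norm s - 1" using s by (intro ln_le_minus_one) simp
  finally show ?thesis by simp
qed

lemma norm_logL_le:
  assumes "\<delta> > 0" "1/2 + \<delta> \<le> Re s" "Re s \<le> 2"
  shows "norm (logL s) \<le> 1 + 3 * (ln (real q) + 11 + 3 * \<bar>Im s\<bar>) / \<delta>"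
proof -
  define c where "c = Complex 2 (Im s)"
  define A where "A = ln (real q) + 11 + 3 * \<bar>Im s\<bar>"
  have A: "A \<ge> 0" using q_gt_1 by (simp add: A_def)
  have "c - s = of_real (2 - Re s)" by (simp add: c_def complex_eq_iff)
  then have dist: "dist c s = 2 - Re s" using assms by (simp only: dist_norm norm_of_real)
  have logL_c: "norm (logL c) \<le> 1"
    using logL_eq_suminf[of c] norm_suminf_logL_term_le[of 1 c] ln_2_less_1 by (simp add: c_def)
  have in_ball: "Re w > 1/2" "norm w < \<bar>Im s\<bar> + 7/2" if "w \<in> ball c (3/2)" for w
    using that abs_Re_le_cmod[of "w - c"] norm_triangle_sub[of w c] cmod_le[of c]
    by (auto simp: c_def dist_norm norm_minus_commute)
  have "norm (logL s - logL c) \<le> 2 * A * dist c s / (3/2 - dist c s)"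
  proof (rule Borel_Caratheodory)
    show "logL holomorphic_on ball c (3/2)"
      by (rule holomorphic_on_subset[OF holomorphic_logL]) (use in_ball in auto)
    show "s \<in> ball c (3/2)" using assms dist by simp
    show "Re (logL w - logL c) < A" if "w \<in> ball c (3/2)" for w
      using Re_logL_le[OF in_ball(1)[OF that]] in_ball(2)[OF that] logL_c
        abs_Re_le_cmod[of "logL c"]
      by (simp add: A_def)
  qed
  also have "\<dots> \<le> 2 * A * (3/2) / \<delta>"
    unfolding dist using assms A by (intro frac_le mult_left_mono) auto
  finally have "norm (logL s - logL c) \<le> 3 * A / \<delta>" by simp
  then show ?thesis
    using logL_c norm_triangle_sub[of "logL s" "logL c"] unfolding A_def by linarith
qed

end

section \<open>Approximation of the logarithm by a short sum\<close>

lemma norm_le_on_strip: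
  assumes holh: "h holomorphic_on {z. a \<le> Re z \<and> Re z \<le> b}"
    and edges: "\<And>z. Re z = a \<or> Re z = b \<Longrightarrow> norm (h z) \<le> B"
    and decay: "\<And>z. a \<le> Re z \<Longrightarrow> Re z \<le> b \<Longrightarrow> norm (h z) \<le> D \<bar>Im z\<bar>" "(D \<longlongrightarrow> 0) at_top"
    and z: "a \<le> Re z" "Re z \<le> b"
  shows "norm (h z) \<le> B"
proof -
  have "norm (h z) \<le> max B (D T)" if T: "T > \<bar>Im z\<bar>" for T
  proof (rule maximum_modulus_frontier[of h "cbox (Complex a (-T)) (Complex b T)"])
    let ?S = "cbox (Complex a (-T)) (Complex b T)"
    have strip: "?S \<subseteq> {z. a \<le> Re z \<and> Re z \<le> b}" by (auto simp: in_cbox_complex_iff)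
    then show "h holomorphic_on interior ?S"
      by (intro holomorphic_on_subset[OF holh]) (use interior_subset in blast)
    show "continuous_on (closure ?S) h"
      using strip by (intro holomorphic_on_imp_continuous_on holomorphic_on_subset[OF holh]) simp
    show "z \<in> ?S" using z T by (auto simp: in_cbox_complex_iff)
    fix w assume "w \<in> frontier ?S"
    then have w: "w \<in> ?S" "w \<notin> box (Complex a (-T)) (Complex b T)"
      by (auto simp: frontier_def)
    then consider "Re w = a \<or> Re w = b" | "a \<le> Re w" "Re w \<le> b" "\<bar>Im w\<bar> = T"
      by (fastforce simp: in_cbox_complex_iff in_box_complex_iff)
    then show "norm (h w) \<le> max B (D T)"
      by cases (use edges[of w] decay(1)[of w] in auto)
  qed simp
  then have "\<forall>\<^sub>F T in at_top. norm (h z) \<le> max B (D T)"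
    by (auto intro: eventually_mono[OF eventually_gt_at_top])
  moreover have "((\<lambda>T. max B (D T)) \<longlongrightarrow> max B 0) at_top" by (intro tendsto_intros decay(2))
  ultimately have "norm (h z) \<le> max B 0" by (intro tendsto_lowerbound) auto
  moreover have "B \<ge> 0" using order.trans[OF norm_ge_zero edges[of "Complex a 0"]] by simp
  ultimately show ?thesis by simp
qed

lemma abs_mult_exp_neg_square_le_1: "\<bar>t\<bar> * exp (- t\<^sup>2) \<le> (1::real)"
proof -
  have "\<bar>t\<bar> \<le> 1 + t\<^sup>2"
    using zero_le_power2[of "\<bar>t\<bar> - 1"] zero_le_power2[of t] by (simp add: power2_diff)
  also have "\<dots> \<le> exp (t\<^sup>2)" by (rule exp_ge_add_one_self)
  finally show ?thesis by (simp add: exp_minus field_simps)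
qed

definition primepow_head :: "real \<Rightarrow> nat \<Rightarrow> real" where
  "primepow_head \<eta> N = (\<Sum>n=1..N. primepow_weight n * real n powr (\<eta> - 1))"

definition primepow_tail :: "nat \<Rightarrow> real" where
  "primepow_tail N = (\<Sum>n. primepow_weight (n + Suc N) * real (n + Suc N) powr (-2))"

lemma primepow_head_nonneg: "primepow_head \<eta> N \<ge> 0"
  unfolding primepow_head_def by (intro sum_nonneg mult_nonneg_nonneg primepow_weight_nonneg) auto

lemma summable_primepow_tail:
  "summable (\<lambda>n. primepow_weight (n + Suc N) * real (n + Suc N) powr (-2))"
  using summable_primepow_weight_powr[of 1] by (subst summable_iff_shift) simp

lemma primepow_tail_nonneg: "primepow_tail N \<ge> 0"
  unfolding primepow_tail_def
  by (intro suminf_nonneg summable_primepow_tail mult_nonneg_nonneg primepow_weight_nonneg) auto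

definition left_edge_error :: "real \<Rightarrow> nat \<Rightarrow> nat \<Rightarrow> real" where
  "left_edge_error \<eta> q N =
     exp 1 * (real N powr (-\<eta>) * (1 + 3 * (ln (real q) + 14) / (1/2 - \<eta>) + primepow_head \<eta> N))"

definition right_edge_error :: "nat \<Rightarrow> real" where
  "right_edge_error N = exp 1 * (real N * primepow_tail N)"

definition approx_error :: "real \<Rightarrow> nat \<Rightarrow> nat \<Rightarrow> real" where
  "approx_error \<eta> q N = left_edge_error \<eta> q N + right_edge_error N"

context L_logarithm
begin

definition partial_logL :: "nat \<Rightarrow> complex \<Rightarrow> complex" where
  "partial_logL N s = (\<Sum>n\<le>N. logL_term n s)"

definition logL_remainder :: "nat \<Rightarrow> complex \<Rightarrow> complex" where
  "logL_remainder N s = logL s - partial_logL N s"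

text \<open>The factor \<open>N\<^sup>z\<close> balances the error on the two vertical sides of the strip, \<open>exp (z\<^sup>2)\<close> makes it
  decay vertically, and both equal \<open>1\<close> at \<open>z = 0\<close>.\<close>

definition smoothed_remainder :: "nat \<Rightarrow> complex \<Rightarrow> complex" where
  "smoothed_remainder N z = logL_remainder N (1 + z) * of_nat N powr z * exp (z ^ 2)"

lemma norm_smoothed_remainder:
  "norm (smoothed_remainder N z) =
     norm (logL_remainder N (1 + z)) * real N powr Re z * exp ((Re z)\<^sup>2 - (Im z)\<^sup>2)"
  by (simp add: smoothed_remainder_def norm_mult norm_of_nat_powr Re_power2)

lemma holomorphic_smoothed_remainder:
  assumes "N \<ge> 1"
  shows "smoothed_remainder N holomorphic_on {z. Re z > -1/2}"
proof -
  have "logL_remainder N holomorphic_on {s. Re s > 1/2}"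
    unfolding logL_remainder_def partial_logL_def logL_term_def
    by (intro holomorphic_intros holomorphic_logL)
  then have "(logL_remainder N \<circ> (\<lambda>z. 1 + z)) holomorphic_on {z. Re z > -1/2}"
    by (rule holomorphic_on_compose_gen[rotated]) (auto intro: holomorphic_intros)
  then show ?thesis
    unfolding smoothed_remainder_def o_def using assms by (intro holomorphic_intros) auto
qed

lemma norm_partial_logL_le:
  "norm (partial_logL N s) \<le> (\<Sum>n=1..N. primepow_weight n * real n powr (- Re s))"
proof -
  have "norm (partial_logL N s) \<le> (\<Sum>n\<le>N. primepow_weight n * real n powr (- Re s))"
    unfolding partial_logL_def by (intro sum_norm_le norm_logL_term_le)
  also have "\<dots> = (\<Sum>n=1..N. primepow_weight n * real n powr (- Re s))"
    by (intro sum.mono_neutral_right) (auto simp: Suc_le_eq)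
  finally show ?thesis .
qed

lemma norm_logL_remainder_2_le:
  assumes "Re s = 2"
  shows "norm (logL_remainder N s) \<le> primepow_tail N"
proof -
  have summable: "summable (\<lambda>n. norm (logL_term n s))"
    using assms by (intro summable_logL_term) simp
  then have summable_tail: "summable (\<lambda>n. norm (logL_term (n + Suc N) s))"
    by (subst summable_iff_shift)
  have "logL_remainder N s = (\<Sum>n. logL_term (n + Suc N) s)"
    using logL_eq_suminf[of s] assms
      suminf_split_initial_segment[OF summable_norm_cancel[OF summable], of "Suc N"]
    by (simp add: logL_remainder_def partial_logL_def lessThan_Suc_atMost)
  also have "norm \<dots> \<le> (\<Sum>n. norm (logL_term (n + Suc N) s))"
    by (rule summable_norm[OF summable_tail])
  also have "\<dots> \<le> primepow_tail N"
    unfolding primepow_tail_def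
    by (rule suminf_le[OF _ summable_tail summable_primepow_tail])
      (use norm_logL_term_le[of _ s] assms in metis)
  finally show ?thesis .
qed

lemma norm_smoothed_remainder_right_le:
  assumes "Re z = 1"
  shows "norm (smoothed_remainder N z) \<le> right_edge_error N"
proof -
  have "norm (smoothed_remainder N z) \<le> primepow_tail N * real N powr 1 * exp (1 - 0)"
    unfolding norm_smoothed_remainder assms using primepow_tail_nonneg[of N] assms
    by (intro mult_mono norm_logL_remainder_2_le) auto
  then show ?thesis by (simp add: right_edge_error_def mult_ac)
qed

lemma norm_smoothed_remainder_left_le:
  assumes \<eta>: "0 < \<eta>" "\<eta> < 1/2" and z: "Re z = -\<eta>"
  shows "norm (smoothed_remainder N z) \<le> left_edge_error \<eta> q N"
proof -
  define \<delta> where "\<delta> = 1/2 - \<eta>"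
  define C where "C = 1 + 3 * (ln (real q) + 11) / \<delta> + primepow_head \<eta> N"
  let ?R = "norm (logL_remainder N (1 + z))" and ?g = "exp (- (Im z)\<^sup>2)"
  have \<delta>: "\<delta> > 0" using \<eta> by (simp add: \<delta>_def)
  have C: "C \<ge> 0"
    using \<delta> q_gt_1 primepow_head_nonneg[of \<eta> N] unfolding C_def
    by (intro add_nonneg_nonneg divide_nonneg_nonneg) auto
  have "norm (logL (1 + z)) \<le> 1 + 3 * (ln (real q) + 11 + 3 * \<bar>Im z\<bar>) / \<delta>"
    using norm_logL_le[OF \<delta>, of "1 + z"] \<eta> z by (simp add: \<delta>_def)
  moreover have "norm (partial_logL N (1 + z)) \<le> primepow_head \<eta> N"
    using norm_partial_logL_le[of N "1 + z"] z by (simp add: primepow_head_def)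
  ultimately have "?R \<le> C + 9 / \<delta> * \<bar>Im z\<bar>"
    using norm_triangle_ineq4[of "logL (1 + z)" "partial_logL N (1 + z)"]
    by (simp add: C_def logL_remainder_def add_divide_distrib algebra_simps)
  then have "?R * ?g \<le> (C + 9 / \<delta> * \<bar>Im z\<bar>) * ?g"
    by (rule mult_right_mono) simp
  also have "\<dots> = C * ?g + 9 / \<delta> * (\<bar>Im z\<bar> * ?g)"
    by (simp add: algebra_simps)
  also have "\<dots> \<le> C * 1 + 9 / \<delta> * 1"
    using C \<delta> abs_mult_exp_neg_square_le_1 by (intro add_mono mult_left_mono) auto
  also have "\<dots> = 1 + 3 * (ln (real q) + 14) / \<delta> + primepow_head \<eta> N"
    by (simp add: C_def add_divide_distrib algebra_simps)
  finally have gauss: "?R * ?g \<le> 1 + 3 * (ln (real q) + 14) / \<delta> + primepow_head \<eta> N" .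
  have "norm (smoothed_remainder N z) = ?R * ?g * (real N powr (-\<eta>) * exp (\<eta>\<^sup>2))"
    unfolding norm_smoothed_remainder z by (simp add: exp_diff exp_minus field_simps)
  also have "\<dots> \<le> (1 + 3 * (ln (real q) + 14) / \<delta> + primepow_head \<eta> N) * (real N powr (-\<eta>) * exp 1)"
    using \<eta> order.trans[OF _ gauss, of 0] by (intro mult_mono gauss) (auto simp: abs_square_le_1)
  finally show ?thesis by (simp add: left_edge_error_def \<delta>_def mult_ac)
qed

lemma norm_smoothed_remainder_strip_le:
  assumes \<eta>: "0 < \<eta>" "\<eta> < 1/2" and z: "-\<eta> \<le> Re z" "Re z \<le> 1" and "N \<ge> 1"
  shows "norm (smoothed_remainder N z)
     \<le> (1 + 3 * (ln (real q) + 11 + 3 * \<bar>Im z\<bar>) / (1/2 - \<eta>) + real N) * real N * exp (1 - \<bar>Im z\<bar>\<^sup>2)"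
proof -
  have "norm (partial_logL N (1 + z)) \<le> (\<Sum>n=1..N. primepow_weight n * real n powr (- Re (1 + z)))"
    by (rule norm_partial_logL_le)
  also have "\<dots> \<le> (\<Sum>n=1..N. 1 * 1)"
  proof (intro sum_mono mult_mono primepow_weight_le_1)
    show "real n powr (- Re (1 + z)) \<le> 1" if "n \<in> {1..N}" for n
      using z \<eta> that powr_mono[of "- Re (1 + z)" 0 "real n"] by simp
  qed auto
  finally have "norm (partial_logL N (1 + z)) \<le> real N" by simp
  moreover have "norm (logL (1 + z)) \<le> 1 + 3 * (ln (real q) + 11 + 3 * \<bar>Im z\<bar>) / (1/2 - \<eta>)"
    using norm_logL_le[of "1/2 - \<eta>" "1 + z"] \<eta> z by simp
  ultimately have "norm (logL_remainder N (1 + z))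
      \<le> 1 + 3 * (ln (real q) + 11 + 3 * \<bar>Im z\<bar>) / (1/2 - \<eta>) + real N"
    using norm_triangle_ineq4[of "logL (1 + z)" "partial_logL N (1 + z)"]
    unfolding logL_remainder_def by linarith
  moreover have "real N powr Re z \<le> real N"
    using \<open>N \<ge> 1\<close> z powr_mono[of "Re z" 1 "real N"] by simp
  moreover have "exp ((Re z)\<^sup>2 - (Im z)\<^sup>2) \<le> exp (1 - \<bar>Im z\<bar>\<^sup>2)"
    using z \<eta> by (simp add: abs_square_le_1 abs_le_iff)
  moreover have "0 \<le> 1 + 3 * (ln (real q) + 11 + 3 * \<bar>Im z\<bar>) / (1/2 - \<eta>) + real N"
    using \<eta> q_gt_1 by (intro add_nonneg_nonneg divide_nonneg_nonneg) auto
  ultimately show ?thesis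
    unfolding norm_smoothed_remainder by (intro mult_mono mult_nonneg_nonneg) auto
qed

theorem norm_logL_remainder_1_le:
  assumes \<eta>: "0 < \<eta>" "\<eta> < 1/2" and N: "N \<ge> 1"
  shows "norm (logL_remainder N 1) \<le> approx_error \<eta> q N"
proof -
  have nonneg: "0 \<le> left_edge_error \<eta> q N" "0 \<le> right_edge_error N"
    using \<eta> q_gt_1 primepow_head_nonneg[of \<eta> N] primepow_tail_nonneg[of N]
    by (auto simp: left_edge_error_def right_edge_error_def)
  have "norm (smoothed_remainder N 0) \<le> approx_error \<eta> q N"
  proof (rule norm_le_on_strip[where h = "smoothed_remainder N"])
    show "smoothed_remainder N holomorphic_on {z. -\<eta> \<le> Re z \<and> Re z \<le> 1}"
      by (rule holomorphic_on_subset[OF holomorphic_smoothed_remainder[OF N]]) (use \<eta> in auto)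
    show "norm (smoothed_remainder N z) \<le> approx_error \<eta> q N" if "Re z = -\<eta> \<or> Re z = 1" for z
      using that nonneg norm_smoothed_remainder_left_le[OF \<eta>, of z N]
        norm_smoothed_remainder_right_le[of z N]
      unfolding approx_error_def by linarith
    define C where "C = 1 + 3 * (ln (real q) + 11) / (1/2 - \<eta>) + real N"
    have "((\<lambda>T::real. exp (1 - T\<^sup>2)) \<longlongrightarrow> 0) at_top"
        "((\<lambda>T::real. T * exp (1 - T\<^sup>2)) \<longlongrightarrow> 0) at_top"
      by real_asymp+
    then have "((\<lambda>T. C * real N * exp (1 - T\<^sup>2)
        + 9 / (1/2 - \<eta>) * real N * (T * exp (1 - T\<^sup>2))) \<longlongrightarrow> 0) at_top"
      by (intro tendsto_add_zero tendsto_mult_right_zero)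
    then show "((\<lambda>T. (1 + 3 * (ln (real q) + 11 + 3 * T) / (1/2 - \<eta>) + real N) * real N
        * exp (1 - T\<^sup>2)) \<longlongrightarrow> 0) at_top"
      by (simp add: C_def add_divide_distrib algebra_simps)
  qed (use norm_smoothed_remainder_strip_le[OF \<eta> _ _ N] \<eta> in auto)
  then show ?thesis using N by (simp add: smoothed_remainder_def)
qed

end

section \<open>Decay of the approximation error\<close>

lemma sum_mult_antimono_le:
  fixes a b w :: "nat \<Rightarrow> real"
  assumes partial: "\<And>k. (\<Sum>j\<le>k. a j) \<le> (\<Sum>j\<le>k. b j)"
    and w: "\<And>k. w (Suc k) \<le> w k" "\<And>k. w k \<ge> 0"
  shows "(\<Sum>k<n. a k * w k) \<le> (\<Sum>k<n. b k * w k)"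
proof -
  have "(\<Sum>j<n. a j) \<le> (\<Sum>j<n. b j)"
    using partial by (cases n) (auto simp: lessThan_Suc_atMost)
  then show ?thesis
    unfolding summation_by_parts[of a w] summation_by_parts[of b w]
    using w
    by (intro add_mono[OF sum_mono mult_right_mono]) (auto intro: mult_right_mono[OF partial])
qed

lemma sum_mangoldt_weighted_le:
  fixes w :: "nat \<Rightarrow> real"
  assumes "\<And>n. n \<ge> 1 \<Longrightarrow> w (Suc n) \<le> w n" "\<And>n. w n \<ge> 0"
  shows "(\<Sum>n=1..N. mangoldt n * w n) \<le> 4 * (\<Sum>n=1..N. w n)"
proof -
  have "(\<Sum>j\<le>k. mangoldt (Suc j) :: real) \<le> (\<Sum>j\<le>k. 4)" for k
    using sum_mangoldt_le[of "Suc k"] by (simp add: sum.atMost_Suc_shift del: sum.atMost_Suc)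
  then have "(\<Sum>k<N. mangoldt (Suc k) * w (Suc k)) \<le> (\<Sum>k<N. 4 * w (Suc k))"
    by (rule sum_mult_antimono_le) (use assms in auto)
  then show ?thesis by (simp add: sum.atLeast1_atMost_eq sum_distrib_left)
qed

lemma sum_powr_le:
  fixes \<eta> :: real
  assumes "0 < \<eta>" "\<eta> \<le> 1"
  shows "(\<Sum>n=1..N. real n powr (\<eta> - 1)) \<le> real N powr \<eta> / \<eta>"
proof (induction N)
  case (Suc N)
  have "real (Suc N) powr (\<eta> - 1) \<le> (real (Suc N) powr \<eta> - real N powr \<eta>) / \<eta>"
  proof (cases "N = 0")
    case False
    then show ?thesis
      using powr_le_diff_quotient[of "real N" "-\<eta>"] assms
      by (simp add: add.commute minus_divide_right[symmetric] diff_divide_distrib)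
  qed (use assms in auto)
  then show ?case using Suc by (simp add: diff_divide_distrib del: of_nat_Suc)
qed auto

lemma primepow_weight_le_mangoldt:
  assumes "N \<ge> 2" "N \<le> n ^ k"
  shows "primepow_weight n \<le> real k / ln (real N) * mangoldt n"
proof (cases "n \<le> 1")
  case True
  then show ?thesis using assms(1) by (auto simp: le_Suc_eq)
next
  case False
  have "real N \<le> real n ^ k" using assms(2) by (simp flip: of_nat_power)
  then have "ln (real N) \<le> ln (real n ^ k)" using assms(1) False by (intro ln_mono) auto
  then have "ln (real N) \<le> real k * ln (real n)" using False by (simp add: ln_realpow)
  then have "mangoldt n * (1 / ln (real n)) \<le> mangoldt n * (real k / ln (real N))"
    using assms(1) False by (intro mult_left_mono mangoldt_nonneg) (auto simp: field_simps)
  then show ?thesis by (simp add: primepow_weight_def mult.commute)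
qed

text \<open>Splitting at \<open>n = \<surd>N\<close> gains the factor \<open>1 / ln N\<close> over the trivial bound \<open>w \<le> 1\<close>.\<close>

lemma primepow_head_term_le:
  assumes \<eta>: "\<eta> > 0" and N: "N \<ge> 2" and n: "n \<in> {1..N}"
  shows "primepow_weight n * real n powr (\<eta> - 1)
    \<le> real N powr (\<eta>/4) * real n powr (\<eta>/2 - 1)
      + 2 / ln (real N) * (mangoldt n * real n powr (\<eta> - 1))"
proof (cases "n ^ 2 \<le> N")
  case True
  have "primepow_weight n * real n powr (\<eta> - 1) \<le> real n powr (\<eta> - 1)"
    by (intro mult_left_le_one_le primepow_weight_nonneg primepow_weight_le_1) auto
  also have "\<dots> = (real n ^ 2) powr (\<eta>/4) * real n powr (\<eta>/2 - 1)"
    using n powr_powr[of "real n" 2 "\<eta>/4"] by (simp add: powr_numeral flip: powr_add)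
  also have "\<dots> \<le> real N powr (\<eta>/4) * real n powr (\<eta>/2 - 1)"
    using True \<eta> by (intro mult_right_mono powr_mono2) (auto simp flip: of_nat_power)
  finally show ?thesis using N by (simp add: add_increasing2 mangoldt_nonneg)
next
  case False
  then have "primepow_weight n * real n powr (\<eta> - 1)
      \<le> 2 / ln (real N) * mangoldt n * real n powr (\<eta> - 1)"
    using primepow_weight_le_mangoldt[OF N, of n 2] by (intro mult_right_mono) auto
  then show ?thesis by (simp add: add_increasing mult.assoc)
qed

lemma primepow_head_le:
  assumes \<eta>: "0 < \<eta>" "\<eta> \<le> 1" and N: "N \<ge> 2"
  shows "primepow_head \<eta> N \<le> real N powr (\<eta>/4) * (real N powr (\<eta>/2) / (\<eta>/2))
      + 2 / ln (real N) * (4 * (real N powr \<eta> / \<eta>))"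
proof -
  have "primepow_head \<eta> N \<le> (\<Sum>n=1..N. real N powr (\<eta>/4) * real n powr (\<eta>/2 - 1)
      + 2 / ln (real N) * (mangoldt n * real n powr (\<eta> - 1)))"
    unfolding primepow_head_def by (intro sum_mono primepow_head_term_le \<eta>(1) N)
  also have "\<dots> = real N powr (\<eta>/4) * (\<Sum>n=1..N. real n powr (\<eta>/2 - 1))
      + 2 / ln (real N) * (\<Sum>n=1..N. mangoldt n * real n powr (\<eta> - 1))"
    by (simp add: sum.distrib sum_distrib_left)
  also have "\<dots> \<le> real N powr (\<eta>/4) * (real N powr (\<eta>/2) / (\<eta>/2))
      + 2 / ln (real N) * (4 * (real N powr \<eta> / \<eta>))"
  proof (intro add_mono mult_left_mono)
    show "(\<Sum>n=1..N. real n powr (\<eta>/2 - 1)) \<le> real N powr (\<eta>/2) / (\<eta>/2)"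
      using \<eta> by (intro sum_powr_le) auto
    have "(\<Sum>n=1..N. mangoldt n * real n powr (\<eta> - 1)) \<le> 4 * (\<Sum>n=1..N. real n powr (\<eta> - 1))"
      using \<eta> by (intro sum_mangoldt_weighted_le powr_mono2') auto
    also have "\<dots> \<le> 4 * (real N powr \<eta> / \<eta>)"
      using sum_powr_le[OF \<eta>, of N] by simp
    finally show "(\<Sum>n=1..N. mangoldt n * real n powr (\<eta> - 1)) \<le> 4 * (real N powr \<eta> / \<eta>)" .
  qed (use N in auto)
  finally show ?thesis .
qed

lemma primepow_head_tendsto:
  assumes "0 < \<eta>" "\<eta> \<le> 1"
  shows "(\<lambda>N. real N powr (-\<eta>) * primepow_head \<eta> N) \<longlonglongrightarrow> 0"
proof (rule tendsto_sandwich[of "\<lambda>_. 0"])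
  let ?U = "\<lambda>N. real N powr (\<eta>/4) * (real N powr (\<eta>/2) / (\<eta>/2))
      + 2 / ln (real N) * (4 * (real N powr \<eta> / \<eta>))"
  show "(\<lambda>N. real N powr (-\<eta>) * ?U N) \<longlonglongrightarrow> 0"
    using assms by real_asymp
  show "\<forall>\<^sub>F N in sequentially. real N powr (-\<eta>) * primepow_head \<eta> N \<le> real N powr (-\<eta>) * ?U N"
    using eventually_ge_at_top[of 2]
    by eventually_elim (intro mult_left_mono primepow_head_le assms; simp)
qed (auto intro!: always_eventually simp: primepow_head_nonneg)

lemma sum_mangoldt_powr_tail_le:
  assumes "\<sigma> > 0" "N \<ge> 1"
  shows "(\<Sum>n<M. mangoldt (n + Suc N) * real (n + Suc N) powr (-(1 + \<sigma>)))
      \<le> 4 * (1 + 1 / \<sigma>) * real N powr (-\<sigma>)"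
proof -
  define w where "w n = real (max n N) powr (-(1 + \<sigma>))" for n
  have shift: "(\<Sum>n\<in>{N<..N+M}. g n) = (\<Sum>n<M. g (n + Suc N))" for g :: "nat \<Rightarrow> real"
    by (rule sum.reindex_bij_witness[of _ "\<lambda>n. n + Suc N" "\<lambda>n. n - Suc N"]) auto
  have "(\<Sum>n<M. mangoldt (n + Suc N) * real (n + Suc N) powr (-(1 + \<sigma>)))
      = (\<Sum>n\<in>{N<..N+M}. mangoldt n * w n)"
    unfolding shift by (simp add: w_def max_def)
  also have "\<dots> \<le> (\<Sum>n=1..N+M. mangoldt n * w n)"
    by (rule sum_mono2) (auto intro!: mult_nonneg_nonneg mangoldt_nonneg simp: w_def)
  also have "\<dots> \<le> 4 * (\<Sum>n=1..N+M. w n)"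
    using assms by (intro sum_mangoldt_weighted_le) (auto simp: w_def intro!: powr_mono2')
  also have "(\<Sum>n=1..N+M. w n) = (\<Sum>n=1..N. w n) + (\<Sum>n\<in>{N<..N+M}. w n)"
    by (subst sum.union_disjoint[symmetric]) (auto intro!: sum.cong)
  also have "(\<Sum>n=1..N. w n) = (\<Sum>n=1..N. real N powr (-(1 + \<sigma>)))"
    by (intro sum.cong) (auto simp: w_def max_def)
  also have "\<dots> = real N powr (-\<sigma>)"
    using powr_mult_base[of "real N" "-(1 + \<sigma>)"] by simp
  also have "(\<Sum>n\<in>{N<..N+M}. w n) = (\<Sum>n<M. real (n + Suc N) powr (-(1 + \<sigma>)))"
    unfolding shift by (simp add: w_def max_def)
  also have "\<dots> \<le> (\<Sum>n. real (n + Suc N) powr (-(1 + \<sigma>)))"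
    by (intro sum_le_suminf summable_powr_tail assms(1)) auto
  also have "\<dots> \<le> real N powr (-\<sigma>) / \<sigma>" by (rule suminf_powr_tail_le[OF assms])
  finally show ?thesis by (simp add: algebra_simps)
qed

lemma primepow_tail_le:
  assumes "N \<ge> 2"
  shows "primepow_tail N \<le> 8 / (real N * ln (real N))"
  unfolding primepow_tail_def
proof (rule suminf_le_const[OF summable_primepow_tail])
  fix M
  have "(\<Sum>n<M. primepow_weight (n + Suc N) * real (n + Suc N) powr (-2))
      \<le> (\<Sum>n<M. 1 / ln (real N) * (mangoldt (n + Suc N) * real (n + Suc N) powr (-(1 + 1))))"
  proof (rule sum_mono)
    show "primepow_weight (n + Suc N) * real (n + Suc N) powr (-2)
        \<le> 1 / ln (real N) * (mangoldt (n + Suc N) * real (n + Suc N) powr (-(1 + 1)))" for n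
      using mult_right_mono[OF primepow_weight_le_mangoldt[OF assms, of "n + Suc N" 1],
          of "real (n + Suc N) powr (-2)"]
      by simp
  qed
  also have "\<dots> \<le> 1 / ln (real N) * (4 * (1 + 1 / 1) * real N powr (-1))"
    unfolding sum_distrib_left[symmetric]
    using assms by (intro mult_left_mono sum_mangoldt_powr_tail_le) auto
  also have "\<dots> = 8 / (real N * ln (real N))"
    using assms by (simp add: powr_minus divide_inverse)
  finally show "(\<Sum>n<M. primepow_weight (n + Suc N) * real (n + Suc N) powr (-2))
      \<le> 8 / (real N * ln (real N))" .
qed

lemma primepow_tail_tendsto: "(\<lambda>N. real N * primepow_tail N) \<longlonglongrightarrow> 0"
proof (rule tendsto_sandwich[of "\<lambda>_. 0" _ _ "\<lambda>N. 8 / ln (real N)"])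
  show "(\<lambda>N. 8 / ln (real N)) \<longlonglongrightarrow> 0" by real_asymp
  show "\<forall>\<^sub>F N in sequentially. real N * primepow_tail N \<le> 8 / ln (real N)"
    using eventually_ge_at_top[of 2]
  proof eventually_elim
    case (elim N)
    then show ?case using mult_left_mono[OF primepow_tail_le[OF elim], of "real N"] by simp
  qed
qed (auto intro!: always_eventually mult_nonneg_nonneg primepow_tail_nonneg)

definition littlewood_scale :: "nat \<Rightarrow> real" where
  "littlewood_scale q = exp euler_mascheroni * ln (ln (real q))"

lemma eventually_littlewood_scale_pos: "\<forall>\<^sub>F q in sequentially. littlewood_scale q > 0"
  unfolding littlewood_scale_def by real_asymp

definition cutoff :: "real \<Rightarrow> nat \<Rightarrow> nat" where
  "cutoff a q = nat \<lceil>ln (real q) powr a\<rceil>"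

lemma cutoff_bounds:
  "ln (real q) powr a \<le> real (cutoff a q)"
  "real (cutoff a q) \<le> ln (real q) powr a + 1"
  using powr_ge_zero[of "ln (real q)" a] unfolding cutoff_def by linarith+

lemma filterlim_cutoff:
  assumes "a > 0"
  shows "filterlim (cutoff a) at_top sequentially"
proof -
  have "filterlim (\<lambda>q::nat. ln (real q) powr a) at_top sequentially" using assms by real_asymp
  then have "filterlim (\<lambda>q. real (cutoff a q)) at_top sequentially"
    by (rule filterlim_at_top_mono) (simp add: cutoff_bounds)
  then show ?thesis by (simp add: filterlim_sequentially_iff_filterlim_real)
qed

lemma cutoff_powr_mult_ln_tendsto:
  assumes \<eta>: "0 < \<eta>" "\<eta> < 1/2" and a: "a * \<eta> > 1"
  shows "(\<lambda>q. real (cutoff a q) powr (-\<eta>) * (1 + 3 * (ln (real q) + 14) / (1/2 - \<eta>))) \<longlonglongrightarrow> 0"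
proof (rule tendsto_sandwich[of "\<lambda>_. 0"])
  let ?C = "\<lambda>q. 1 + 3 * (ln (real q) + 14) / (1/2 - \<eta>)"
  have \<eta>': "1/2 - \<eta> > 0" using \<eta> by simp
  then show "(\<lambda>q. (ln (real q) powr a) powr (-\<eta>) * ?C q) \<longlonglongrightarrow> 0"
    unfolding powr_powr using a by real_asymp
  have nonneg: "\<forall>\<^sub>F q in sequentially. ?C q \<ge> 0 \<and> ln (real q) > 0"
    using eventually_gt_at_top[of 1] by eventually_elim (use \<eta>' in \<open>auto intro!: add_nonneg_nonneg\<close>)
  then show "\<forall>\<^sub>F q in sequentially. 0 \<le> real (cutoff a q) powr (-\<eta>) * ?C q"
    by eventually_elim simp
  from nonneg show "\<forall>\<^sub>F q in sequentially. real (cutoff a q) powr (-\<eta>) * ?C q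
      \<le> (ln (real q) powr a) powr (-\<eta>) * ?C q"
  proof eventually_elim
    case (elim q)
    then show ?case using \<eta> by (intro mult_right_mono powr_mono2' cutoff_bounds) auto
  qed
qed auto

lemma approx_error_tendsto:
  assumes \<eta>: "0 < \<eta>" "\<eta> < 1/2" and a: "a * \<eta> > 1"
  shows "(\<lambda>q. approx_error \<eta> q (cutoff a q)) \<longlonglongrightarrow> 0"
proof -
  have "0 < a * \<eta>" using a by simp
  then have cutoff: "filterlim (cutoff a) at_top sequentially"
    using \<eta> by (intro filterlim_cutoff) (simp add: zero_less_mult_iff)
  have "(\<lambda>q. real (cutoff a q) powr (-\<eta>) * primepow_head \<eta> (cutoff a q)) \<longlonglongrightarrow> 0"
    using \<eta> by (intro filterlim_compose[OF primepow_head_tendsto cutoff]) auto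
  from tendsto_add[OF cutoff_powr_mult_ln_tendsto[OF \<eta> a] this]
  have "(\<lambda>q. left_edge_error \<eta> q (cutoff a q)) \<longlonglongrightarrow> 0"
    unfolding left_edge_error_def by (intro tendsto_mult_right_zero) (simp add: distrib_left)
  moreover have "(\<lambda>q. right_edge_error (cutoff a q)) \<longlonglongrightarrow> 0"
    unfolding right_edge_error_def
    by (rule tendsto_mult_right_zero[OF filterlim_compose[OF primepow_tail_tendsto cutoff]])
  ultimately show ?thesis unfolding approx_error_def by (rule tendsto_add_zero)
qed

lemma eventually_ln_cutoff_le:
  assumes "0 < a" "a < b"
  shows "\<forall>\<^sub>F q in sequentially. ln (real (cutoff a q)) \<le> b * ln (ln (real q))"
proof -
  have "\<forall>\<^sub>F q::nat in sequentially. ln (real q) > 1 \<and> ln (ln (real q) powr a + 1)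
      \<le> b * ln (ln (real q))"
    using assms by (intro eventually_conj; real_asymp)
  then show ?thesis
  proof eventually_elim
    case (elim q)
    then have "0 < ln (real q) powr a" by simp
    then have "ln (real (cutoff a q)) \<le> ln (ln (real q) powr a + 1)"
      using cutoff_bounds[where q = q and a = a] by (intro ln_mono) linarith+
    then show ?case using elim by simp
  qed
qed

lemma eventually_primepow_harm_cutoff_le:
  assumes "0 < a" "a < b"
  shows "\<forall>\<^sub>F q in sequentially. primepow_harm (cutoff a q) \<le> ln (b * littlewood_scale q)"
proof -
  obtain c where c: "a < c" "c < b" using dense[OF assms(2)] by auto
  have "euler_mascheroni < euler_mascheroni + (ln b - ln c)" using assms c by simp
  from filterlim_cutoff[OF assms(1)] eventually_primepow_harm_less[OF this]
  have "\<forall>\<^sub>F q in sequentially. primepow_harm (cutoff a q)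
      < ln (ln (real (cutoff a q))) + (euler_mascheroni + (ln b - ln c))"
    by (rule eventually_compose_filterlim[rotated])
  moreover have "\<forall>\<^sub>F q in sequentially. 2 \<le> cutoff a q"
    using filterlim_cutoff[OF assms(1)] by (simp add: filterlim_at_top)
  moreover note eventually_ln_cutoff_le[OF assms(1) c(1)]
  moreover have "\<forall>\<^sub>F q::nat in sequentially. ln (ln (real q)) > 0" by real_asymp
  ultimately show ?thesis
  proof eventually_elim
    case (elim q)
    have "ln (ln (real (cutoff a q))) \<le> ln (c * ln (ln (real q)))"
      using elim by (intro ln_mono) auto
    then show ?case using elim assms c by (simp add: littlewood_scale_def ln_mult)
  qed
qed

lemma cutoff_small_error_exists:
  assumes "b > 2"
  obtains N \<eta> \<delta> where "0 < \<eta>" "\<eta> < 1/2" "\<delta> > 0" "filterlim N at_top sequentially"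
    "\<forall>\<^sub>F q in sequentially. 1 \<le> N q \<and> 0 < littlewood_scale q \<and> approx_error \<eta> q (N q) < \<delta> \<and>
       primepow_harm (N q) \<le> ln (b * littlewood_scale q) - 3 * \<delta>"
proof -
  obtain c where c: "2 < c" "c < b" using dense[OF assms] by auto
  obtain a where a: "2 < a" "a < c" using dense[OF c(1)] by auto
  then have "1 / a < 1/2" by (simp add: field_simps)
  from dense[OF this] obtain \<eta> where \<eta>: "1 / a < \<eta>" "\<eta> < 1/2" by auto
  then have "0 < \<eta>" "a * \<eta> > 1" using a by (auto simp: field_simps intro: less_trans[of 0 "1 / a"])
  define \<delta> where "\<delta> = (ln b - ln c) / 3"
  have \<delta>: "\<delta> > 0" "3 * \<delta> = ln b - ln c" using c by (simp_all add: \<delta>_def)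
  have cutoff: "filterlim (cutoff a) at_top sequentially" using a by (intro filterlim_cutoff) simp
  then have "\<forall>\<^sub>F q in sequentially. 1 \<le> cutoff a q" by (simp add: filterlim_at_top)
  moreover note eventually_littlewood_scale_pos
  moreover have "\<forall>\<^sub>F q in sequentially. approx_error \<eta> q (cutoff a q) < \<delta>"
    using order_tendstoD(2)[OF approx_error_tendsto[OF \<open>0 < \<eta>\<close> \<eta>(2) \<open>a * \<eta> > 1\<close>] \<delta>(1)] .
  moreover have "\<forall>\<^sub>F q in sequentially. primepow_harm (cutoff a q)
      \<le> ln (c * littlewood_scale q)"
    using a by (intro eventually_primepow_harm_cutoff_le) auto
  ultimately have "\<forall>\<^sub>F q in sequentially.
      1 \<le> cutoff a q \<and> 0 < littlewood_scale q \<and> approx_error \<eta> q (cutoff a q) < \<delta> \<and>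
      primepow_harm (cutoff a q) \<le> ln (b * littlewood_scale q) - 3 * \<delta>"
    by eventually_elim (use c in \<open>simp add: \<delta>(2) ln_mult\<close>)
  then show ?thesis by (rule that[OF \<open>0 < \<eta>\<close> \<eta>(2) \<delta>(1) cutoff])
qed

section \<open>Bounds for \<open>L(1, \<chi>)\<close>\<close>

context nonprincipal_character
begin

theorem abs_ln_norm_dirichlet_L_1_minus_sum_le:
  assumes nonzero: "\<And>s. Re s > 1/2 \<Longrightarrow> dirichlet_L chi s \<noteq> 0" and \<eta>: "0 < \<eta>" "\<eta> < 1/2" and N: "N \<ge> 1"
  shows "\<bar>ln (norm (dirichlet_L chi 1)) - (\<Sum>n\<le>N. primepow_weight n / real n * Re (chi n))\<bar>
      \<le> approx_error \<eta> q N"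
proof -
  obtain logL where "L_logarithm q chi logL" using L_logarithm_exists[OF nonzero] .
  then interpret L_logarithm q chi logL .
  have "norm (dirichlet_L chi 1) = exp (Re (logL 1))"
    using exp_logL[of 1] by (simp flip: norm_exp_eq_Re)
  moreover have "logL_term n 1 = of_real (primepow_weight n / real n) * chi n" for n
    by (cases "n = 0") (auto simp: logL_term_def powr_minus divide_inverse)
  then have "Re (partial_logL N 1) = (\<Sum>n\<le>N. primepow_weight n / real n * Re (chi n))"
    unfolding partial_logL_def Re_sum
    by (simp only: Re_complex_of_real Im_complex_of_real times_complex.sel mult_zero_left diff_zero)
  moreover have "\<bar>Re (logL_remainder N 1)\<bar> \<le> approx_error \<eta> q N"
    by (rule order.trans[OF abs_Re_le_cmod norm_logL_remainder_1_le[OF \<eta> N]])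
  ultimately show ?thesis by (simp add: logL_remainder_def)
qed

lemma sum_primepow_weight_Re_chi_le:
  "(\<Sum>n\<le>N. primepow_weight n / real n * Re (chi n)) \<le> primepow_harm N"
  unfolding primepow_harm_def
proof (rule sum_mono)
  fix n
  have "Re (chi n) \<le> 1" using complex_Re_le_cmod[of "chi n"] norm_chi_le_1[of n] by linarith
  then show "primepow_weight n / real n * Re (chi n) \<le> primepow_weight n / real n"
    by (intro mult_left_le) (auto simp: primepow_weight_nonneg)
qed

end

theorem eventually_norm_dirichlet_L_1_le:
  assumes GRH "b > 2"
  shows "\<forall>\<^sub>F q in sequentially. \<forall>chi.
      dirichlet_char q chi \<and> \<not> principal_char q chi \<and> \<not> principal_char q (\<lambda>n. chi n ^ 2)
      \<longrightarrow> norm (dirichlet_L chi 1) \<le> b * littlewood_scale q"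
proof -
  obtain N \<eta> \<delta> where \<eta>: "0 < \<eta>" "\<eta> < 1/2" and \<delta>: "\<delta> > 0"
    and small: "\<forall>\<^sub>F q in sequentially.
      1 \<le> N q \<and> 0 < littlewood_scale q \<and> approx_error \<eta> q (N q) < \<delta> \<and>
      primepow_harm (N q) \<le> ln (b * littlewood_scale q) - 3 * \<delta>"
    by (rule cutoff_small_error_exists[OF assms(2)])
  from small show ?thesis
  proof (eventually_elim, intro allI impI)
    fix q chi
    assume q: "1 \<le> N q \<and> 0 < littlewood_scale q \<and> approx_error \<eta> q (N q) < \<delta> \<and>
        primepow_harm (N q) \<le> ln (b * littlewood_scale q) - 3 * \<delta>"
      and chi: "dirichlet_char q chi \<and> \<not> principal_char q chi \<and> \<not> principal_char q (\<lambda>n. chi n ^ 2)"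
    interpret nonprincipal_character q chi using chi by unfold_locales auto
    have nonzero: "dirichlet_L chi s \<noteq> 0" if "Re s > 1/2" for s
      using dirichlet_L_nonzero[OF assms(1) _ that] chi by blast
    have "ln (norm (dirichlet_L chi 1)) \<le> ln (b * littlewood_scale q)"
      using abs_ln_norm_dirichlet_L_1_minus_sum_le[OF nonzero \<eta>, of "N q"]
        sum_primepow_weight_Re_chi_le[of "N q"] q \<delta>
      by linarith
    then show "norm (dirichlet_L chi 1) \<le> b * littlewood_scale q"
      using nonzero[of 1] q assms(2) by (subst (asm) ln_le_cancel_iff) auto
  qed
qed

section \<open>Cubic characters\<close>

lemma Re_ge_if_cube_root_unity:
  fixes z :: complex
  assumes "z ^ 3 = 1"
  shows "Re z \<ge> -1/2"
proof (cases "z = 1")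
  case False
  have "(z - 1) * (z ^ 2 + z + 1) = z ^ 3 - 1"
    by (simp add: algebra_simps power2_eq_square power3_eq_cube)
  then have eq: "z ^ 2 + z + 1 = 0" using assms False by simp
  have "Im z * (2 * Re z + 1) = 0"
    using arg_cong[OF eq, of Im] by (simp add: power2_eq_square algebra_simps)
  moreover have "Im z \<noteq> 0"
  proof
    assume "Im z = 0"
    then have "(Re z)\<^sup>2 + Re z + 1 = 0"
      using arg_cong[OF eq, of Re] by (simp add: power2_eq_square)
    moreover have "(Re z)\<^sup>2 + Re z + 1 = (Re z + 1/2)\<^sup>2 + 3/4"
      by (simp add: power2_eq_square algebra_simps)
    ultimately show False using zero_le_power2[of "Re z + 1/2"] by linarith
  qed
  ultimately show ?thesis by simp
qed auto

definition primepow_cubes :: "nat \<Rightarrow> real" where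
  "primepow_cubes N = (\<Sum>m | m ^ 3 \<le> N. primepow_weight m / real m ^ 3)"

lemma cubes_le_subset: "{m. m ^ 3 \<le> N} \<subseteq> {..N::nat}"
proof
  fix m assume m: "m \<in> {m. m ^ 3 \<le> N}"
  have "m \<le> m ^ 3" by (cases "m = 0") (auto simp: self_le_power)
  then show "m \<in> {..N}" using m by simp
qed

lemma finite_cubes_le: "finite {m::nat. m ^ 3 \<le> N}"
  using finite_subset[OF cubes_le_subset] by simp

lemma summable_inverse_cube: "summable (\<lambda>n. 1 / real n ^ 3)"
  using inverse_power_summable[of 3, where 'a = real] by (simp add: inverse_eq_divide)

lemma primepow_weight_cube_sums_ln_zeta3: "(\<lambda>n. primepow_weight n / real n ^ 3) sums ln zeta3"
  and zeta3_pos: "zeta3 > 0"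
proof -
  have "exp (\<Sum>n. primepow_weight n * (1 / real n ^ 3)) = (\<Sum>n. 1 / real n ^ 3)"
    by (rule exp_suminf_primepow_weight_real)
      (use summable_inverse_cube in \<open>auto simp: power_mult_distrib\<close>)
  also have "\<dots> = zeta3"
    using suminf_split_head[OF summable_inverse_cube] by (simp add: zeta3_def)
  finally have zeta3_eq: "zeta3 = exp (\<Sum>n. primepow_weight n / real n ^ 3)" by simp
  then show "zeta3 > 0" by (metis exp_gt_zero)
  have "summable (\<lambda>n. primepow_weight n / real n ^ 3)"
    using summable_norm_cancel[OF summable_primepow_weight_mult[of "\<lambda>n. 1 / real n ^ 3"]]
      summable_inverse_cube by simp
  then show "(\<lambda>n. primepow_weight n / real n ^ 3) sums ln zeta3"
    unfolding zeta3_eq by (simp add: summable_sums)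
qed

lemma eventually_primepow_cubes_greater:
  assumes "c < ln zeta3"
  shows "\<forall>\<^sub>F N in sequentially. c < primepow_cubes N"
proof -
  obtain M where M: "c < (\<Sum>n<M. primepow_weight n / real n ^ 3)"
    using order_tendstoD(1)[OF primepow_weight_cube_sums_ln_zeta3[unfolded sums_def] assms]
    by (auto simp: eventually_sequentially)
  show ?thesis
    using eventually_ge_at_top[of "M ^ 3"]
  proof eventually_elim
    case (elim N)
    have "m ^ 3 \<le> N" if "m < M" for m
      using that elim power_mono[of m M 3] by linarith
    then have "(\<Sum>n<M. primepow_weight n / real n ^ 3) \<le> primepow_cubes N"
      unfolding primepow_cubes_def
      by (intro sum_mono2 finite_cubes_le divide_nonneg_nonneg primepow_weight_nonneg) auto
    then show ?case using M by simp
  qed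
qed

lemma sum_primepow_weight_cubes_le:
  "(\<Sum>m\<in>{m. m ^ 3 \<le> N} - A. primepow_weight m / real m ^ 3)
      \<le> (\<Sum>n\<in>{..N} - A. primepow_weight n / real n)"
proof -
  have "primepow_weight m / real m ^ 3 \<le> primepow_weight m / real m" for m
  proof (cases "m = 0")
    case False
    then have "real m \<le> real m ^ 3" by (intro self_le_power) auto
    then show ?thesis using False by (intro divide_left_mono primepow_weight_nonneg) auto
  qed simp
  then have "(\<Sum>m\<in>{m. m ^ 3 \<le> N} - A. primepow_weight m / real m ^ 3)
      \<le> (\<Sum>m\<in>{m. m ^ 3 \<le> N} - A. primepow_weight m / real m)"
    by (rule sum_mono)
  also have "\<dots> \<le> (\<Sum>n\<in>{..N} - A. primepow_weight n / real n)"
    using cubes_le_subset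
    by (intro sum_mono2) (auto intro!: divide_nonneg_nonneg primepow_weight_nonneg)
  finally show ?thesis .
qed

locale cubic_character =
  fixes q :: nat and chi :: "nat \<Rightarrow> complex"
  assumes order3: "char_order3 q chi"
begin

sublocale nonprincipal_character q chi
  using order3 by unfold_locales (auto simp: char_order3_def)

lemma chi_cube: "chi n ^ 3 = (if coprime n q then 1 else 0)"
  using order3 unfolding char_order3_def by blast

lemma square_not_principal: "\<not> principal_char q (\<lambda>n. chi n ^ 2)"
proof
  assume "principal_char q (\<lambda>n. chi n ^ 2)"
  then have "chi n = (if coprime n q then 1 else 0)" for n
    using chi_cube[of n] chi_eq_0_iff[of n]
    by (auto simp: principal_char_def power3_eq_cube power2_eq_square)
  then show False using not_principal by (simp add: principal_char_def)
qed

lemma sum_Re_chi_coprime_ge: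
  assumes a: "\<And>n. a n \<ge> 0" and S: "finite S" "\<And>n. n \<in> S \<Longrightarrow> coprime n q"
    and C: "C \<subseteq> range (\<lambda>m. m ^ 3) \<inter> S"
  shows "(\<Sum>n\<in>S. a n * Re (chi n)) \<ge> 3/2 * (\<Sum>n\<in>C. a n) - 1/2 * (\<Sum>n\<in>S. a n)"
proof -
  have split: "(\<Sum>n\<in>S. g n) = (\<Sum>n\<in>S - C. g n) + (\<Sum>n\<in>C. g n)" for g :: "nat \<Rightarrow> real"
    using C S(1) by (intro sum.subset_diff) auto
  have "(\<Sum>n\<in>S - C. a n) * (-1/2) \<le> (\<Sum>n\<in>S - C. a n * Re (chi n))"
    unfolding sum_distrib_right using chi_cube S
    by (intro sum_mono mult_left_mono Re_ge_if_cube_root_unity a) auto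
  moreover have "chi n = 1" if n: "n \<in> C" for n
  proof -
    obtain m where "n = m ^ 3" "coprime (m ^ 3) q" using n C S(2) by fastforce
    then show ?thesis using chi_cube[of m] by (simp add: chi_power)
  qed
  then have "(\<Sum>n\<in>C. a n * Re (chi n)) = (\<Sum>n\<in>C. a n)" by simp
  ultimately show ?thesis
    unfolding split[of "\<lambda>n. a n * Re (chi n)"] split[of a] by argo
qed

text \<open>The terms with \<open>n\<close> not coprime to \<open>q\<close> vanish on the left, and on the right they contribute a
  nonpositive amount.\<close>

theorem sum_primepow_weight_Re_chi_ge:
  "(\<Sum>n\<le>N. primepow_weight n / real n * Re (chi n)) \<ge> (primepow_cubes N - primepow_harm N) / 2"
proof -
  define A where "A = {n. coprime n q}"
  define a where "a n = primepow_weight n / real n" for n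
  let ?C = "{m::nat. m ^ 3 \<le> N}"
  have "Re (chi n) = 0" if "n \<notin> A" for n
    using that chi_eq_0_iff[of n] by (simp add: A_def)
  then have "(\<Sum>n\<le>N. a n * Re (chi n)) = (\<Sum>n\<in>{..N} \<inter> A. a n * Re (chi n))"
    by (intro sum.mono_neutral_right) auto
  also have "\<dots> \<ge> 3/2 * (\<Sum>n\<in>(\<lambda>m. m ^ 3) ` (?C \<inter> A). a n) - 1/2 * (\<Sum>n\<in>{..N} \<inter> A. a n)"
    by (rule sum_Re_chi_coprime_ge) (auto simp: A_def a_def primepow_weight_nonneg)
  moreover have "(\<Sum>n\<in>(\<lambda>m. m ^ 3) ` (?C \<inter> A). a n) = (\<Sum>m\<in>?C \<inter> A. primepow_weight m / real m ^ 3) / 3"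
    by (subst sum.reindex)
      (auto intro!: inj_onI simp: power_eq_iff_eq_base a_def primepow_weight_cube
        sum_divide_distrib mult.commute)
  moreover have "primepow_cubes N
      = (\<Sum>m\<in>?C \<inter> A. primepow_weight m / real m ^ 3) + (\<Sum>m\<in>?C - A. primepow_weight m / real m ^ 3)"
    unfolding primepow_cubes_def by (rule sum.Int_Diff[OF finite_cubes_le])
  moreover have "primepow_harm N = (\<Sum>n\<in>{..N} \<inter> A. a n) + (\<Sum>n\<in>{..N} - A. a n)"
    unfolding primepow_harm_def a_def by (rule sum.Int_Diff) simp
  moreover have "(\<Sum>m\<in>?C - A. primepow_weight m / real m ^ 3) \<le> (\<Sum>n\<in>{..N} - A. a n)"
    unfolding a_def by (rule sum_primepow_weight_cubes_le)
  ultimately show ?thesis unfolding a_def[symmetric] by argo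
qed

end

corollary eventually_norm_dirichlet_L_1_le_cubic:
  assumes GRH "b > 2"
  shows "\<forall>\<^sub>F q in sequentially. \<forall>chi. char_order3 q chi
    \<longrightarrow> norm (dirichlet_L chi 1) \<le> b * littlewood_scale q"
  using eventually_norm_dirichlet_L_1_le[OF assms]
proof eventually_elim
  case (elim q)
  have "dirichlet_char q chi \<and> \<not> principal_char q chi \<and> \<not> principal_char q (\<lambda>n. chi n ^ 2)"
    if "char_order3 q chi" for chi
    using that cubic_character.square_not_principal[of q chi]
    by (auto simp: char_order3_def cubic_character_def)
  then show ?case using elim by blast
qed

theorem eventually_norm_dirichlet_L_1_ge_sqrt_cubic:
  assumes GRH "b > 2"
  shows "\<forall>\<^sub>F q in sequentially. \<forall>chi. char_order3 q chi
    \<longrightarrow> sqrt (zeta3 / (b * littlewood_scale q)) \<le> norm (dirichlet_L chi 1)"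
proof -
  obtain N \<eta> \<delta> where \<eta>: "0 < \<eta>" "\<eta> < 1/2" and \<delta>: "\<delta> > 0" and N: "filterlim N at_top sequentially"
    and small: "\<forall>\<^sub>F q in sequentially.
      1 \<le> N q \<and> 0 < littlewood_scale q \<and> approx_error \<eta> q (N q) < \<delta> \<and>
      primepow_harm (N q) \<le> ln (b * littlewood_scale q) - 3 * \<delta>"
    by (rule cutoff_small_error_exists[OF assms(2)])
  have "\<forall>\<^sub>F q in sequentially. ln zeta3 - \<delta> < primepow_cubes (N q)"
    using eventually_compose_filterlim[OF eventually_primepow_cubes_greater N] \<delta> by simp
  with small show ?thesis
  proof (eventually_elim, intro allI impI)
    fix q chi
    define M where "M = b * littlewood_scale q"
    assume "1 \<le> N q \<and> 0 < littlewood_scale q \<and> approx_error \<eta> q (N q) < \<delta> \<and>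
        primepow_harm (N q) \<le> ln (b * littlewood_scale q) - 3 * \<delta>"
    then have q: "1 \<le> N q" "M > 0" "approx_error \<eta> q (N q) < \<delta>" "primepow_harm (N q) \<le> ln M - 3 * \<delta>"
      using assms(2) by (auto simp: M_def)
    assume cubes: "ln zeta3 - \<delta> < primepow_cubes (N q)" and "char_order3 q chi"
    interpret cubic_character q chi by unfold_locales fact
    have nonzero: "dirichlet_L chi s \<noteq> 0" if "Re s > 1/2" for s
      by (rule dirichlet_L_nonzero[OF assms(1) square_not_principal that])
    have "ln (sqrt (zeta3 / M)) = (ln zeta3 - ln M) / 2"
      using q(2) zeta3_pos by (simp add: ln_sqrt ln_div)
    also have "\<dots> \<le> (primepow_cubes (N q) - primepow_harm (N q)) / 2 - approx_error \<eta> q (N q)"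
      using q cubes by (simp add: field_simps)
    also have "\<dots> \<le> ln (norm (dirichlet_L chi 1))"
      using abs_ln_norm_dirichlet_L_1_minus_sum_le[OF nonzero \<eta> q(1)]
        sum_primepow_weight_Re_chi_ge[of "N q"]
      by linarith
    finally show "sqrt (zeta3 / (b * littlewood_scale q)) \<le> norm (dirichlet_L chi 1)"
      using nonzero[of 1] q(2) zeta3_pos unfolding M_def[symmetric]
      by (subst (asm) ln_le_cancel_iff) auto
  qed
qed

corollary eventually_norm_dirichlet_L_1_ge_cubic:
  assumes GRH "c < 1 / sqrt 2"
  shows "\<forall>\<^sub>F q in sequentially. \<forall>chi. char_order3 q chi
    \<longrightarrow> c * sqrt (zeta3 / littlewood_scale q) \<le> norm (dirichlet_L chi 1)"
proof -
  have "((\<lambda>b. 1 / sqrt b) \<longlongrightarrow> 1 / sqrt 2) (at_right 2)" by (intro tendsto_intros) auto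
  from order_tendstoD(1)[OF this assms(2)] obtain b where b: "c < 1 / sqrt b" "b > 2"
    using eventually_happens'[OF trivial_limit_at_right_real
      eventually_conj[OF _ eventually_at_right_less]] by blast
  from eventually_norm_dirichlet_L_1_ge_sqrt_cubic[OF assms(1) b(2)] eventually_littlewood_scale_pos
  show ?thesis
  proof eventually_elim
    case (elim q)
    have "c * sqrt (zeta3 / littlewood_scale q) \<le> 1 / sqrt b * sqrt (zeta3 / littlewood_scale q)"
      using b(1) elim(2) zeta3_pos by (intro mult_right_mono) auto
    also have "\<dots> = sqrt (zeta3 / (b * littlewood_scale q))"
      by (simp add: real_sqrt_divide real_sqrt_mult)
    finally show ?case using elim(1) by (auto intro: order.trans)
  qed
qed

theorem theorem1p1:
  assumes "GRH"
  shows "\<forall>\<epsilon>>0. \<exists>Q::nat. \<forall>q chi. q \<ge> Q \<and> primitive_char q chi \<and> char_order3 q chi \<longrightarrow>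
           (1 / sqrt 2 - \<epsilon>) * sqrt (zeta3 / (exp euler_mascheroni * ln (ln (real q))))
              \<le> cmod (dirichlet_L chi 1) \<and>
           cmod (dirichlet_L chi 1) \<le> (2 + \<epsilon>) * exp euler_mascheroni * ln (ln (real q))"
proof (intro allI impI)
  fix \<epsilon> :: real assume "\<epsilon> > 0"
  then have "\<forall>\<^sub>F q in sequentially. \<forall>chi. char_order3 q chi \<longrightarrow>
      (1 / sqrt 2 - \<epsilon>) * sqrt (zeta3 / littlewood_scale q) \<le> cmod (dirichlet_L chi 1)"
    by (intro eventually_norm_dirichlet_L_1_ge_cubic assms) simp
  moreover have "\<forall>\<^sub>F q in sequentially. \<forall>chi. char_order3 q chi \<longrightarrow>
      cmod (dirichlet_L chi 1) \<le> (2 + \<epsilon>) * littlewood_scale q"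
    using \<open>\<epsilon> > 0\<close> by (intro eventually_norm_dirichlet_L_1_le_cubic assms) simp
  ultimately have "\<forall>\<^sub>F q in sequentially. \<forall>chi. char_order3 q chi \<longrightarrow>
      (1 / sqrt 2 - \<epsilon>) * sqrt (zeta3 / littlewood_scale q) \<le> cmod (dirichlet_L chi 1) \<and>
      cmod (dirichlet_L chi 1) \<le> (2 + \<epsilon>) * littlewood_scale q"
    by eventually_elim blast
  then show "\<exists>Q::nat. \<forall>q chi. q \<ge> Q \<and> primitive_char q chi \<and> char_order3 q chi \<longrightarrow>
           (1 / sqrt 2 - \<epsilon>) * sqrt (zeta3 / (exp euler_mascheroni * ln (ln (real q))))
              \<le> cmod (dirichlet_L chi 1) \<and>
           cmod (dirichlet_L chi 1) \<le> (2 + \<epsilon>) * exp euler_mascheroni * ln (ln (real q))"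
    unfolding eventually_sequentially littlewood_scale_def mult.assoc by blast
qed

end
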